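(* For every finite symmetric generating set $S$ of the Heisenberg group $G=H_3(\mathbb{Z})$, the complete growth series of $(G,S)$ is not $\mathbb{N}G$-algebraic.
   Context: $H_3(\mathbb{Z})=\langle x,y\mid [x,y]\text{ central}\rangle$. For a group $G$ with finite symmetric generating set $S$, $\|g\|_S$ denotes the word length of $g\in G$. $\mathbb{N}G$ is the group semiring (finite formal sums of elements of $G$ with coefficients in $\mathbb{N}=\{0,1,2,\dots\}$), and $\mathbb{N}G[[s]]$ is the semiring of formal power series over it, the variable $s$ commuting with coefficients. The complete growth series of $(G,S)$ is $\sum_{n\ge 0}\big(\sum_{\|g\|_S=n} g\big)s^n\in\mathbb{N}G[[s]]$. A series in $\mathbb{N}G[[s]]$ is proper if its constant coefficient is $0$. A proper algebraic system over $\mathbb{N}G[s]$ is a finite system of equations $X_i=P_i(X_1,\dots,X_n)$, $i=1,\dots,n$, where each $P_i$ is a polynomial in non-commuting variables (not commuting with the coefficients either), i.e. a finite sum of monomials $r_0X_{i_1}r_1X_{i_2}r_2\cdots X_{i_d}r_d\cdot s^k$ with integers $d,k\ge0$, $1\le i_j\le n$, $r_j\in\mathbb{N}G$, and where no monomial has $(d,k)=(0,0)$ or $(d,k)=(1,0)$. Such a system has a unique solution $(F_1,\dots,F_n)$ consisting of proper series. A series $F=\sum_{n\ge0}a_ns^n\in\mathbb{N}G[[s]]$ is $\mathbb{N}G$-algebraic if $\sum_{n\ge1}a_ns^n$ is the first component of the proper solution of some proper algebraic system over $\mathbb{N}G[s]$. *)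

theory Defs
  imports
    "HOL-Library.Poly_Mapping"
    "HOL-Computational_Algebra.Formal_Power_Series"
begin

section \<open>The Heisenberg group, by generators and relations\<close>

datatype gen = X | Y

text \<open>A letter is a generator together with a sign: \<open>(a, True)\<close> stands for \<open>a\<close> and
  \<open>(a, False)\<close> for its inverse.\<close>

type_synonym letter = "gen \<times> bool"

definition inv_letter :: "letter \<Rightarrow> letter" where
  "inv_letter l = (fst l, \<not> snd l)"

definition inv_word :: "letter list \<Rightarrow> letter list" where
  "inv_word w = rev (map inv_letter w)"

definition comm_word :: "letter list" where
  "comm_word = [(X, True), (Y, True), (X, False), (Y, False)]"

text \<open>The least congruence on words containing the free cancellations and
  the relations saying that \<open>[x, y]\<close> commutes with every letter.\<close>

inductive heis_rel :: "letter list \<Rightarrow> letter list \<Rightarrow> bool" where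
  refl: "heis_rel u u"
| sym: "heis_rel u v \<Longrightarrow> heis_rel v u"
| trans: "heis_rel u v \<Longrightarrow> heis_rel v w \<Longrightarrow> heis_rel u w"
| append: "heis_rel u u' \<Longrightarrow> heis_rel v v' \<Longrightarrow> heis_rel (u @ v) (u' @ v')"
| cancel: "heis_rel [l, inv_letter l] []"
| central: "heis_rel (comm_word @ [l]) (l # comm_word)"

lemma inv_letter_inv_letter [simp]: "inv_letter (inv_letter l) = l"
  by (simp add: inv_letter_def)

lemma heis_rel_append_inv: "heis_rel (w @ inv_word w) []"
proof (induction w)
  case Nil
  show ?case by (simp add: inv_word_def heis_rel.refl)
next
  case (Cons l w)
  have "heis_rel ([l] @ ((w @ inv_word w) @ [inv_letter l])) ([l] @ ([] @ [inv_letter l]))"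
    by (intro heis_rel.append heis_rel.refl Cons.IH)
  then show ?case
    using heis_rel.trans heis_rel.cancel[of l] by (simp add: inv_word_def)
qed

lemma heis_rel_inv_append: "heis_rel (inv_word w @ w) []"
  using heis_rel_append_inv[of "inv_word w"]
  by (simp add: inv_word_def rev_map[symmetric] comp_def)

lemma heis_rel_inv_word:
  assumes "heis_rel u v"
  shows "heis_rel (inv_word u) (inv_word v)"
proof -
  have 1: "heis_rel (inv_word u @ []) (inv_word u @ (v @ inv_word v))"
    by (intro heis_rel.append heis_rel.refl heis_rel.sym[OF heis_rel_append_inv])
  have 2: "heis_rel (inv_word u @ (v @ inv_word v)) (inv_word u @ (u @ inv_word v))"
    by (intro heis_rel.append heis_rel.refl heis_rel.sym[OF assms])
  have 3: "heis_rel ((inv_word u @ u) @ inv_word v) ([] @ inv_word v)"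
    by (intro heis_rel.append heis_rel.refl heis_rel_inv_append)
  show ?thesis
    using heis_rel.trans[OF heis_rel.trans[OF 1 2]] 3 by simp
qed

quotient_type heis = "letter list" / heis_rel
  by (rule equivpI)
    (auto intro!: reflpI sympI transpI intro: heis_rel.refl heis_rel.sym heis_rel.trans)

text \<open>The library's classes for possibly non-commutative groups are additive, so the group law
  is written \<open>+\<close>.\<close>

instantiation heis :: group_add
begin

lift_definition zero_heis :: heis is "[]" .

lift_definition plus_heis :: "heis \<Rightarrow> heis \<Rightarrow> heis" is "(@)"
  by (rule heis_rel.append)

lift_definition uminus_heis :: "heis \<Rightarrow> heis" is inv_word
  by (rule heis_rel_inv_word)

definition minus_heis :: "heis \<Rightarrow> heis \<Rightarrow> heis" where
  "minus_heis g h = g + (- h)"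

instance
proof
  fix a b c :: heis
  show "a + b + c = a + (b + c)" by transfer (simp add: heis_rel.refl)
  show "0 + a = a" by transfer (simp add: heis_rel.refl)
  show "a + 0 = a" by transfer (simp add: heis_rel.refl)
  show "- a + a = 0" by transfer (rule heis_rel_inv_append)
  show "a + (- b) = a - b" by (simp add: minus_heis_def)
qed

end


section \<open>Generating sets and complete growth series\<close>

definition is_subgroup :: "'g::group_add set \<Rightarrow> bool" where
  "is_subgroup H \<longleftrightarrow> 0 \<in> H \<and> (\<forall>g\<in>H. \<forall>h\<in>H. g + h \<in> H) \<and> (\<forall>g\<in>H. - g \<in> H)"

definition generates :: "'g::group_add set \<Rightarrow> bool" where
  "generates S \<longleftrightarrow> (\<forall>H. is_subgroup H \<and> S \<subseteq> H \<longrightarrow> H = UNIV)"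

definition symmetric :: "'g::group_add set \<Rightarrow> bool" where
  "symmetric S \<longleftrightarrow> (\<forall>g\<in>S. - g \<in> S)"

text \<open>Only meaningful if \<open>S\<close> is a symmetric generating set: \<open>LEAST\<close> is unspecified for
  elements that are not represented by any word over \<open>S\<close>.\<close>

definition word_length :: "'g::group_add set \<Rightarrow> 'g \<Rightarrow> nat" where
  "word_length S g = (LEAST n. \<exists>w. set w \<subseteq> S \<and> length w = n \<and> sum_list w = g)"

text \<open>The semiring \<open>\<nat>G\<close> is \<^typ>\<open>'g \<Rightarrow>\<^sub>0 nat\<close> with the convolution product. For finite \<open>S\<close> the
  spheres below are finite, so the sum is a genuine one.\<close>

definition complete_growth_series :: "'g::group_add set \<Rightarrow> ('g \<Rightarrow>\<^sub>0 nat) fps" where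
  "complete_growth_series S =
     Abs_fps (\<lambda>n. \<Sum>g | word_length S g = n. Poly_Mapping.single g 1)"


section \<open>Proper algebraic systems\<close>

text \<open>\<open>(r\<^sub>0, [(i\<^sub>1, r\<^sub>1), \<dots>, (i\<^sub>d, r\<^sub>d)], k)\<close> encodes the monomial
  \<open>r\<^sub>0 X\<^bsub>i\<^sub>1\<^esub> r\<^sub>1 \<cdots> X\<^bsub>i\<^sub>d\<^esub> r\<^sub>d s\<^sup>k\<close>. Variables are numbered from 0.\<close>

type_synonym 'r monomial = "'r \<times> (nat \<times> 'r) list \<times> nat"

text \<open>A polynomial is a finite sum of monomials; a system \<open>[P\<^sub>0, \<dots>, P\<^bsub>n-1\<^esub>]\<close> stands for the
  equations \<open>X\<^sub>i = P\<^sub>i\<close> with \<open>i < n\<close>.\<close>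

type_synonym 'r polynomial = "'r monomial list"
type_synonym 'r system = "'r polynomial list"

fun proper_monomial :: "nat \<Rightarrow> 'r monomial \<Rightarrow> bool" where
  "proper_monomial n (r, vs, k) \<longleftrightarrow>
     (\<forall>(i, c)\<in>set vs. i < n) \<and> (length vs, k) \<noteq> (0, 0) \<and> (length vs, k) \<noteq> (1, 0)"

definition proper_system :: "'r system \<Rightarrow> bool" where
  "proper_system sys \<longleftrightarrow> (\<forall>P\<in>set sys. \<forall>m\<in>set P. proper_monomial (length sys) m)"

fun eval_monomial :: "'r::semiring_1 fps list \<Rightarrow> 'r monomial \<Rightarrow> 'r fps" where
  "eval_monomial F (r, vs, k) =
     fps_const r * (\<Prod>(i, c)\<leftarrow>vs. F ! i * fps_const c) * fps_X ^ k"

definition eval_polynomial :: "'r::semiring_1 fps list \<Rightarrow> 'r polynomial \<Rightarrow> 'r fps" where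
  "eval_polynomial F P = (\<Sum>m\<leftarrow>P. eval_monomial F m)"

definition proper_fps :: "'r::zero fps \<Rightarrow> bool" where
  "proper_fps f \<longleftrightarrow> fps_nth f 0 = 0"

definition proper_solution :: "'r::semiring_1 system \<Rightarrow> 'r fps list \<Rightarrow> bool" where
  "proper_solution sys F \<longleftrightarrow>
     length F = length sys \<and> (\<forall>f\<in>set F. proper_fps f) \<and>
     (\<forall>i<length sys. F ! i = eval_polynomial F (sys ! i))"

definition proper_part :: "'r::zero fps \<Rightarrow> 'r fps" where
  "proper_part f = Abs_fps (\<lambda>n. if n = 0 then 0 else fps_nth f n)"

text \<open>A proper system has exactly one proper solution, hence the existential quantifier
  over \<open>F\<close>.\<close>

definition algebraic_series :: "'r::semiring_1 fps \<Rightarrow> bool" where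
  "algebraic_series f \<longleftrightarrow>
     (\<exists>sys F. sys \<noteq> [] \<and> proper_system sys \<and> proper_solution sys F \<and> F ! 0 = proper_part f)"

end

theory Submission
  imports Defs
begin

text \<open>Write \<open>D(g) \<in> \<int>\<^sup>2\<close> for the image of \<open>g\<close> in the abelianisation (coordinates \<open>hx\<close>, \<open>hy\<close>) and
  \<open>q(g)\<close> (\<open>hq\<close>) for twice the signed area between a path that spells \<open>g\<close> and its chord. These
  coordinates determine \<open>g\<close>, and \<open>q(gh) = q(g) + q(h) + det(D(g), D(h))\<close>. Geodesics that
  represent central elements are long loops, of length comparable to the square root of the area.

  Suppose that the complete growth series is algebraic. All coefficients are natural numbers, so
  nothing cancels, and the supports of the components of the solution behave like the languages of a
  context-free grammar. The pumping lemma (\<open>pumping\<close>) says that a long element \<open>g\<close> has the form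
  \<open>u v w x y\<close> where \<open>w\<close>, \<open>v w x\<close> and \<open>v v w x x\<close> range over a finite set and where \<open>u v\<^sup>k w x\<^sup>k y\<close>
  has length \<open>\<parallel>g\<parallel> + (k - 1) p\<close> for every \<open>k\<close>, with \<open>p > 0\<close>. The displacement \<open>D(v) + D(x)\<close> is not
  zero, since otherwise the area would grow linearly with \<open>k\<close> and the length like a square root
  (\<open>linear_growth_moves\<close>). Taking \<open>k = 0\<close> and \<open>k = 2\<close>, one sees that \<open>g\<close> is the midpoint of two
  elements with other displacements: the length is affine on these three elements, and so is the
  area, up to a bounded error.

  This contradicts a concavity property of the length at the centre. If \<open>g\<close> has bounded
  displacement and a huge area, then \<open>g\<close> is shorter than the central element of the same area, by an
  amount proportional to the size of \<open>D(g)\<close> up to an additive constant (\<open>center_is_farthest\<close>). The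
  idea is to take a geodesic loop for that central element and to cut out a short piece
  around a point that is extremal in the direction orthogonal to \<open>D(g)\<close>. The piece can be chosen
  such that its chord is almost parallel to \<open>D(g)\<close> and the area hardly changes; repeating this, the
  displacement has to drift away along the line through \<open>D(g)\<close>, because a word that is almost closed
  and much shorter than the loop would contradict that the loop is geodesic. Errors in the area
  are harmless: an error of the order of the length of the loop is corrected by a bounded number of
  letters, by conjugating a long initial piece of the word (\<open>central_correction\<close>).

  Finally one maximises \<open>\<Psi>(g) = \<parallel>g\<parallel> - \<epsilon> q(g) + \<eta> |D(g)|\<^sup>2\<close> over the elements of nonnegative area
  with displacement at most \<open>\<rho>\<close>, for a large \<open>\<rho>\<close>, \<open>\<eta> = 1 / \<rho>\<^sup>2\<close> and a tiny \<open>\<epsilon>\<close>. A maximum exists because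
  the length is at most of the order of the square root of the area, and it is attained at a long
  element as \<open>\<epsilon>\<close> is tiny. It is not attained near the boundary, where the length is
  smaller than in the centre by more than the gain of at most \<open>1\<close> from the quadratic term. So both
  pumped elements are admissible, and as \<open>\<Psi>\<close> is strictly convex along the pump (the area term is
  negligible), one of them has a larger value than the maximum.\<close>


section \<open>Supports of series over the group semiring\<close>

abbreviation keys where "keys \<equiv> Poly_Mapping.keys"

text \<open>A pair \<open>(g, n)\<close> stands for the term \<open>g s\<^sup>n\<close>.\<close>

definition supp :: "('g \<Rightarrow>\<^sub>0 nat) fps \<Rightarrow> ('g \<times> nat) set" where
  "supp f = {(g, n). g \<in> keys (fps_nth f n)}"

lemma in_supp: "(g, n) \<in> supp f \<longleftrightarrow> g \<in> keys (fps_nth f n)"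
  by (simp add: supp_def)

lemma keys_add_nat: "keys (a + b) = keys a \<union> keys (b :: 'g \<Rightarrow>\<^sub>0 nat)"
  by (auto simp: in_keys_iff lookup_add)

lemma keys_sum_nat: "finite A \<Longrightarrow> keys (sum f A) = (\<Union>i\<in>A. keys (f i :: 'g \<Rightarrow>\<^sub>0 nat))"
  by (induction A rule: finite_induct) (auto simp: keys_add_nat)

text \<open>Natural coefficients cannot cancel: splitting one copy of \<open>i\<close> and of \<open>j\<close> off the factors shows that
  \<open>i + j\<close> survives in the product.\<close>

lemma keys_mult_nat:
  fixes a b :: "'g::monoid_add \<Rightarrow>\<^sub>0 nat"
  shows "keys (a * b) = {i + j | i j. i \<in> keys a \<and> j \<in> keys b}"
proof (intro equalityI keys_mult subsetI)
  fix h assume "h \<in> {i + j | i j. i \<in> keys a \<and> j \<in> keys b}"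
  then obtain i j where h: "h = i + j" and i: "i \<in> keys a" and j: "j \<in> keys b" by blast
  have split: "c = Poly_Mapping.single k 1 + (c - Poly_Mapping.single k 1)"
    if "k \<in> keys c" for k and c :: "'g \<Rightarrow>\<^sub>0 nat"
    using that by (intro poly_mapping_eqI)
      (auto simp: lookup_add lookup_minus lookup_single when_def in_keys_iff)
  let ?i = "Poly_Mapping.single i (1::nat)" and ?j = "Poly_Mapping.single j (1::nat)"
  have "a * b = (?i + (a - ?i)) * (?j + (b - ?j))"
    using split[OF i] split[OF j] by simp
  also have "\<dots> = Poly_Mapping.single (i + j) 1 + (?i * (b - ?j) + (a - ?i) * (?j + (b - ?j)))"
    by (simp add: distrib_left distrib_right mult_single ac_simps)
  finally show "h \<in> keys (a * b)" by (simp add: keys_add_nat h)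
qed

lemma supp_add: "supp (f + g) = supp f \<union> supp g"
  by (auto simp: supp_def keys_add_nat)

lemma supp_0 [simp]: "supp 0 = {}"
  by (simp add: supp_def)

lemma supp_sum_list: "supp (sum_list fs) = (\<Union>f\<in>set fs. supp f)"
  by (induction fs) (auto simp: supp_add)

lemma supp_mult:
  fixes f g :: "('g::monoid_add \<Rightarrow>\<^sub>0 nat) fps"
  shows "supp (f * g) = {(a + b, m + n) | a b m n. (a, m) \<in> supp f \<and> (b, n) \<in> supp g}"
proof (intro set_eqI iffI)
  fix z assume "z \<in> supp (f * g)"
  then obtain h k where z: "z = (h, k)" "h \<in> keys (\<Sum>i=0..k. fps_nth f i * fps_nth g (k - i))"
    by (cases z) (auto simp: in_supp fps_mult_nth)
  then obtain i where "i \<le> k" "h \<in> keys (fps_nth f i * fps_nth g (k - i))"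
    by (auto simp: keys_sum_nat)
  then obtain a b where "a \<in> keys (fps_nth f i)" "b \<in> keys (fps_nth g (k - i))" "h = a + b"
    by (auto simp: keys_mult_nat)
  then have "(a, i) \<in> supp f" "(b, k - i) \<in> supp g" "z = (a + b, i + (k - i))"
    using \<open>i \<le> k\<close> z by (auto simp: in_supp)
  then show "z \<in> {(a + b, m + n) | a b m n. (a, m) \<in> supp f \<and> (b, n) \<in> supp g}" by blast
next
  fix z assume "z \<in> {(a + b, m + n) | a b m n. (a, m) \<in> supp f \<and> (b, n) \<in> supp g}"
  then obtain a b m n where z: "z = (a + b, m + n)" "a \<in> keys (fps_nth f m)" "b \<in> keys (fps_nth g n)"
    by (auto simp: in_supp)
  have "a + b \<in> keys (fps_nth f m * fps_nth g (m + n - m))"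
    using z by (auto simp: keys_mult_nat)
  then show "z \<in> supp (f * g)"
    unfolding z in_supp fps_mult_nth by (subst keys_sum_nat) (auto intro!: bexI[of _ m])
qed

lemma supp_const: "supp (fps_const r) = {(a, 0) | a. a \<in> keys r}"
  by (auto simp: supp_def split: if_splits)

lemma supp_1 [simp]: "supp (1 :: ('g::monoid_add \<Rightarrow>\<^sub>0 nat) fps) = {(0, 0)}"
  by (auto simp: supp_def split: if_splits)

lemma supp_X_power: "supp (fps_X ^ k :: ('g::monoid_add \<Rightarrow>\<^sub>0 nat) fps) = {(0, k)}"
  by (auto simp: supp_def fps_X_power_nth split: if_splits)


section \<open>Pumping in algebraic series\<close>

text \<open>The solution of a proper system, seen as a context-free grammar: the equations are productions and
  the support \<open>L i\<close> is the language of the variable \<open>i\<close>. The weight \<open>\<nu>\<close> measures elements of the group;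
  it makes it possible to bound the contexts in which a pump occurs.\<close>

locale algebraic_grammar =
  fixes sys :: "('g::group_add \<Rightarrow>\<^sub>0 nat) system"
    and F :: "('g \<Rightarrow>\<^sub>0 nat) fps list"
    and \<nu> :: "'g \<Rightarrow> nat"
  assumes proper: "proper_system sys"
    and solution: "proper_solution sys F"
    and nu_add: "\<nu> (a + b) \<le> \<nu> a + \<nu> b"
    and nu_0: "\<nu> 0 = 0"
begin

definition L :: "nat \<Rightarrow> ('g \<times> nat) set" where
  "L i = supp (F ! i)"

definition factors :: "(nat \<times> ('g \<Rightarrow>\<^sub>0 nat)) list \<Rightarrow> ('g \<Rightarrow>\<^sub>0 nat) fps" where
  "factors vs = (\<Prod>(i, c)\<leftarrow>vs. F ! i * fps_const c)"

lemma L_pos: "i < length sys \<Longrightarrow> (g, n) \<in> L i \<Longrightarrow> 0 < n"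
  using solution by (cases n) (auto simp: L_def in_supp proper_solution_def proper_fps_def all_set_conv_all_nth)

lemma supp_factors_Cons:
  "supp (factors ((i, c) # vs)) =
     {(h + a + b, m + n) | h a b m n. (h, m) \<in> L i \<and> a \<in> keys c \<and> (b, n) \<in> supp (factors vs)}"
  unfolding factors_def L_def
  apply (simp add: supp_mult supp_const)
  apply safe
   apply blast
  by (metis add.right_neutral)

lemma supp_factors_Nil [simp]: "supp (factors []) = {(0, 0)}"
  by (simp add: factors_def)

lemma L_iff:
  assumes "i < length sys"
  shows "(g, n) \<in> L i \<longleftrightarrow> (\<exists>r vs k a b m. (r, vs, k) \<in> set (sys ! i) \<and> a \<in> keys r \<and>
           (b, m) \<in> supp (factors vs) \<and> g = a + b \<and> n = m + k)"
proof -
  have "F ! i = eval_polynomial F (sys ! i)"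
    using solution assms by (simp add: proper_solution_def)
  then have "L i = (\<Union>m\<in>set (sys ! i). supp (eval_monomial F m))"
    by (simp add: L_def eval_polynomial_def supp_sum_list)
  moreover have "(g, n) \<in> supp (eval_monomial F (r, vs, k)) \<longleftrightarrow>
      (\<exists>a b m. a \<in> keys r \<and> (b, m) \<in> supp (factors vs) \<and> g = a + b \<and> n = m + k)" for r vs k
    by (auto simp: supp_mult supp_const supp_X_power factors_def[symmetric])
  ultimately show ?thesis by fastforce
qed

definition monomials where "monomials = (\<Union>P\<in>set sys. set P)"

text \<open>\<open>B\<close> bounds the number of factors and the exponents of the monomials, \<open>K\<close> the weights of their
  coefficients.\<close>

definition B :: nat where
  "B = (\<Sum>(r, vs, k)\<in>monomials. length vs + k) + 1"

definition K :: nat where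
  "K = (\<Sum>(r, vs, k)\<in>monomials. (\<Sum>a\<in>keys r. \<nu> a) + (\<Sum>(i, c)\<in>set vs. \<Sum>a\<in>keys c. \<nu> a)) + 1"

lemma finite_monomials: "finite monomials"
  by (simp add: monomials_def)

lemma monomial_length:
  assumes "(r, vs, k) \<in> monomials"
  shows "length vs + k < B"
  using member_le_sum[OF assms, of "\<lambda>(r, vs, k). length vs + k"] finite_monomials
  by (simp add: B_def case_prod_beta)

lemma monomial_coeffs:
  assumes "(r, vs, k) \<in> monomials"
  shows "a \<in> keys r \<Longrightarrow> \<nu> a \<le> K"
    and "(i, c) \<in> set vs \<Longrightarrow> a \<in> keys c \<Longrightarrow> \<nu> a \<le> K"
proof -
  have *: "(\<Sum>a\<in>keys r. \<nu> a) + (\<Sum>(i, c)\<in>set vs. \<Sum>a\<in>keys c. \<nu> a) \<le> K"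
    using member_le_sum[OF assms, of "\<lambda>(r, vs, k). (\<Sum>a\<in>keys r. \<nu> a) + (\<Sum>(i, c)\<in>set vs. \<Sum>a\<in>keys c. \<nu> a)"]
      finite_monomials by (simp add: K_def case_prod_beta)
  show "\<nu> a \<le> K" if "a \<in> keys r"
    using member_le_sum[OF that, of \<nu>] * by simp
  show "\<nu> a \<le> K" if "(i, c) \<in> set vs" "a \<in> keys c"
    using member_le_sum[OF that(1), of "\<lambda>(i, c). \<Sum>a\<in>keys c. \<nu> a"] member_le_sum[OF that(2), of \<nu>] *
    by (simp add: case_prod_beta)
qed

lemma monomial_proper:
  assumes "(r, vs, k) \<in> monomials"
  shows "(i, c) \<in> set vs \<Longrightarrow> i < length sys" and "length vs \<le> 1 \<Longrightarrow> 0 < k"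
proof -
  have "proper_monomial (length sys) (r, vs, k)"
    using assms proper by (auto simp: monomials_def proper_system_def simp del: proper_monomial.simps)
  then show "(i, c) \<in> set vs \<Longrightarrow> i < length sys" and "length vs \<le> 1 \<Longrightarrow> 0 < k"
    by (auto simp: le_Suc_eq)
qed

text \<open>Properness of the solution gives every factor a positive length.\<close>

lemma factors_length:
  assumes "\<And>i c. (i, c) \<in> set vs \<Longrightarrow> i < length sys" "(b, m) \<in> supp (factors vs)"
  shows "length vs \<le> m"
  using assms
proof (induction vs arbitrary: b m)
  case (Cons v vs)
  obtain i c where v: "v = (i, c)" by (cases v)
  with Cons.prems(2) obtain h a b' m' n' where *: "(h, m') \<in> L i" "(b', n') \<in> supp (factors vs)" "m = m' + n'"
    by (auto simp: supp_factors_Cons)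
  have "0 < m'" using L_pos[OF _ *(1)] Cons.prems(1)[of i c] v by simp
  moreover have "length vs \<le> n'" using Cons.IH[OF _ *(2)] Cons.prems(1) by (meson list.set_intros(2))
  ultimately show ?case using * by simp
qed simp

text \<open>In a derivation tree of total length \<open>n\<close> the number of nodes is linear in \<open>n\<close>, because every node
  has two children or carries a power of \<open>s\<close>. The surplus \<open>4 * K\<close> on the left pays for the
  coefficients of the monomial that joins several subtrees.\<close>

lemma nu_le_length: "i < length sys \<Longrightarrow> (g, n) \<in> L i \<Longrightarrow> \<nu> g + 4 * K \<le> 8 * K * n"
proof (induction n arbitrary: i g rule: less_induct)
  case (less n)
  obtain r vs k a b m where *: "(r, vs, k) \<in> set (sys ! i)" "a \<in> keys r"
      "(b, m) \<in> supp (factors vs)" "g = a + b" "n = m + k"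
    using less.prems L_iff by blast
  have mon: "(r, vs, k) \<in> monomials" using *(1) less.prems(1) by (auto simp: monomials_def)
  note var = monomial_proper(1)[OF mon] and shape = monomial_proper(2)[OF mon]
    and coeffs = monomial_coeffs[OF mon]
  \<comment> \<open>The induction hypothesis applies to every factor: either \<open>k > 0\<close>, or there are two factors,
    each of positive length.\<close>
  have children: "\<nu> b + 3 * K * length us \<le> 8 * K * m"
    if "(b, m) \<in> supp (factors us)" "set us \<subseteq> set vs" "m < n \<or> 2 \<le> length us \<and> m \<le> n" for b m us
    using that
  proof (induction us arbitrary: b m)
    case Nil
    then show ?case by (simp add: nu_0)
  next
    case (Cons v us)
    obtain j c where v: "v = (j, c)" by (cases v)
    with Cons.prems(1) obtain h a' b' m' n' where p: "(h, m') \<in> L j" "a' \<in> keys c"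
        "(b', n') \<in> supp (factors us)" "m = m' + n'" "b = h + a' + b'"
      by (auto simp: supp_factors_Cons)
    have j: "(j, c) \<in> set vs" using Cons.prems(2) v by simp
    have us: "length us \<le> n'"
      using factors_length[OF _ p(3)] var Cons.prems(2) by (meson set_subset_Cons subset_code(1))
    have "0 < m'" using L_pos[OF var[OF j] p(1)] .
    then have small: "m' < n" "n' < n" using Cons.prems(3) us p(4) by auto
    have "\<nu> b' + 3 * K * length us \<le> 8 * K * n'"
      using Cons.prems p small by (intro Cons.IH) auto
    moreover have "\<nu> h + 4 * K \<le> 8 * K * m'" using less.IH[OF small(1) var[OF j] p(1)] .
    moreover have "\<nu> a' \<le> K" using coeffs(2)[OF j p(2)] .
    moreover have "\<nu> b \<le> \<nu> h + \<nu> a' + \<nu> b'"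
      using nu_add[of "h + a'" b'] nu_add[of h a'] p by simp
    ultimately show ?case using p by (simp add: algebra_simps)
  qed
  have "m < n \<or> 2 \<le> length vs \<and> m \<le> n"
    using shape * by (cases "length vs \<le> 1") auto
  then have "\<nu> b + 3 * K * length vs \<le> 8 * K * m"
    using children[OF *(3)] by blast
  moreover have "\<nu> g \<le> \<nu> a + \<nu> b" "\<nu> a \<le> K" using nu_add coeffs * by auto
  moreover have "5 * K \<le> 3 * K * length vs + 8 * K * k"
  proof (cases "length vs \<le> 1")
    case True
    then have "1 \<le> k" using shape by simp
    then have "8 * K * 1 \<le> 8 * K * k" by (rule mult_le_mono2)
    then show ?thesis by linarith
  next
    case False
    then have "2 \<le> length vs" by simp
    then have "3 * K * 2 \<le> 3 * K * length vs" by (rule mult_le_mono2)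
    then show ?thesis by linarith
  qed
  ultimately show ?case using * by (simp add: algebra_simps)
qed

text \<open>A node \<open>(j, h, m)\<close> occurs in \<open>(i, g, n)\<close> if \<open>(g, n)\<close> arises by putting \<open>(h, m)\<close> into a context
  \<open>u \<cdot> y\<close> of length \<open>q\<close> that sends all of \<open>L j\<close> to \<open>L i\<close>. Two nodes with the same variable therefore
  form a pump. The bound on the left part of the context is additive in \<open>u\<close> and \<open>q\<close>, hence it is preserved when
  contexts are nested.\<close>

definition occurs :: "nat \<times> 'g \<times> nat \<Rightarrow> nat \<times> 'g \<times> nat \<Rightarrow> bool" where
  "occurs = (\<lambda>(i, g, n) (j, h, m). \<exists>u y q. g = u + h + y \<and> n = m + q \<and> \<nu> u \<le> 24 * K * q \<and>
     (\<forall>h' m'. (h', m') \<in> L j \<longrightarrow> (u + h' + y, m' + q) \<in> L i))"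

lemma occurs_refl: "occurs t t"
  unfolding occurs_def by (auto simp: nu_0 intro!: exI[of _ "0 :: 'g"])

lemma occurs_trans:
  assumes "occurs s t" "occurs t r"
  shows "occurs s r"
proof -
  obtain i g n j h m k f l where t: "s = (i, g, n)" "t = (j, h, m)" "r = (k, f, l)"
    by (metis prod_cases3)
  obtain u y q where 1: "g = u + h + y" "n = m + q" "\<nu> u \<le> 24 * K * q"
      "\<And>h' m'. (h', m') \<in> L j \<Longrightarrow> (u + h' + y, m' + q) \<in> L i"
    using assms(1) by (auto simp: occurs_def t)
  obtain u' y' q' where 2: "h = u' + f + y'" "m = l + q'" "\<nu> u' \<le> 24 * K * q'"
      "\<And>h' m'. (h', m') \<in> L k \<Longrightarrow> (u' + h' + y', m' + q') \<in> L j"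
    using assms(2) by (auto simp: occurs_def t)
  have "(u + u' + h' + (y' + y), m' + (q + q')) \<in> L i" if "(h', m') \<in> L k" for h' m'
    using 1(4)[OF 2(4)[OF that]] by (simp add: add.assoc add.commute[of q])
  moreover have "\<nu> (u + u') \<le> 24 * K * (q + q')"
    using nu_add[of u u'] 1 2 by (simp add: algebra_simps)
  moreover have "g = u + u' + f + (y' + y)" "n = l + (q + q')"
    using 1 2 by (simp_all add: add.assoc)
  ultimately show ?thesis unfolding occurs_def t by auto
qed

text \<open>The context around the largest factor of a monomial; its left part is bounded by the total length
  of the other factors.\<close>

lemma largest_factor:
  assumes "\<And>j c. (j, c) \<in> set vs \<Longrightarrow> j < length sys"
    and "\<And>j c a. (j, c) \<in> set vs \<Longrightarrow> a \<in> keys c \<Longrightarrow> \<nu> a \<le> K"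
    and "vs \<noteq> []" "(b, n) \<in> supp (factors vs)"
  shows "\<exists>j u h y m q. j < length sys \<and> b = u + h + y \<and> n = m + q \<and> (h, m) \<in> L j \<and>
           n \<le> length vs * m \<and> \<nu> u \<le> 16 * K * q \<and> length vs \<le> q + 1 \<and>
           (\<forall>h' m'. (h', m') \<in> L j \<longrightarrow> (u + h' + y, m' + q) \<in> supp (factors vs))"
  using assms
proof (induction vs arbitrary: b n)
  case (Cons v vs)
  obtain i c where v: "v = (i, c)" by (cases v)
  with Cons.prems(4) obtain h a b' m n' where p: "(h, m) \<in> L i" "a \<in> keys c"
      "(b', n') \<in> supp (factors vs)" "n = m + n'" "b = h + a + b'"
    by (auto simp: supp_factors_Cons)
  have i: "i < length sys" using Cons.prems(1) v by auto
  have len: "length vs \<le> n'"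
    using factors_length[OF _ p(3)] Cons.prems(1) by (meson list.set_intros(2))
  have head: ?case if "n' \<le> length vs * m"
  proof (intro exI conjI allI impI)
    show "i < length sys" "b = 0 + h + (a + b')" "(h, m) \<in> L i" "n = m + n'"
      using i p by (auto simp: add.assoc)
    show "n \<le> length (v # vs) * m" using that p by simp
    show "\<nu> 0 \<le> 16 * K * n'" by (simp add: nu_0)
    show "length (v # vs) \<le> n' + 1" using len by simp
    fix h' m' assume "(h', m') \<in> L i"
    then have "(h' + a + b', m' + n') \<in> supp (factors (v # vs))"
      unfolding v supp_factors_Cons using p by blast
    then show "(0 + h' + (a + b'), m' + n') \<in> supp (factors (v # vs))"
      by (simp add: add.assoc)
  qed
  show ?case
  proof (cases "n' \<le> length vs * m")
    case False
    then have "vs \<noteq> []" using p(3) by auto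
    then obtain j u h2 y m2 q where IH: "j < length sys" "b' = u + h2 + y" "n' = m2 + q" "(h2, m2) \<in> L j"
        "n' \<le> length vs * m2" "\<nu> u \<le> 16 * K * q" "length vs \<le> q + 1"
        "\<And>h' m'. (h', m') \<in> L j \<Longrightarrow> (u + h' + y, m' + q) \<in> supp (factors vs)"
      using Cons.IH[OF _ _ _ p(3)] Cons.prems(1,2) by (metis list.set_intros(2))
    show ?thesis
    proof (intro exI conjI allI impI)
      show "j < length sys" "b = h + a + u + h2 + y" "n = m2 + (m + q)" "(h2, m2) \<in> L j"
        using IH p by (auto simp: add.assoc)
      have "m \<le> m2"
      proof (rule ccontr)
        assume "\<not> m \<le> m2"
        then have "length vs * m2 \<le> length vs * m" by (intro mult_le_mono2) simp
        then show False using False IH(5) by linarith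
      qed
      then show "n \<le> length (v # vs) * m2" using IH(5) p by simp
      have "\<nu> (h + a + u) \<le> \<nu> h + \<nu> a + \<nu> u"
        using nu_add[of "h + a" u] nu_add[of h a] by simp
      moreover have "\<nu> h + 4 * K \<le> 8 * K * m" using nu_le_length[OF i p(1)] .
      moreover have "\<nu> a \<le> K" using Cons.prems(2) v p by auto
      ultimately show "\<nu> (h + a + u) \<le> 16 * K * (m + q)" using IH by (simp add: algebra_simps)
      show "length (v # vs) \<le> m + q + 1" using IH L_pos[OF i p(1)] by simp
      fix h' m' assume "(h', m') \<in> L j"
      then have "(h + a + (u + h' + y), m + (m' + q)) \<in> supp (factors (v # vs))"
        unfolding v supp_factors_Cons using p IH(8) by blast
      then show "(h + a + u + h' + y, m' + (m + q)) \<in> supp (factors (v # vs))"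
        by (simp add: add.assoc add.left_commute)
    qed
  qed (rule head)
qed simp

lemma smaller_occurrence:
  assumes "i < length sys" "(g, n) \<in> L i" "B \<le> n"
  shows "\<exists>j h m. j < length sys \<and> (h, m) \<in> L j \<and> occurs (i, g, n) (j, h, m) \<and> m < n \<and> n \<le> B * m + B"
proof -
  obtain r vs k a b l where *: "(r, vs, k) \<in> set (sys ! i)" "a \<in> keys r"
      "(b, l) \<in> supp (factors vs)" "g = a + b" "n = l + k"
    using assms L_iff by blast
  have mon: "(r, vs, k) \<in> monomials" using *(1) assms(1) by (auto simp: monomials_def)
  have len: "length vs + k < B" using monomial_length[OF mon] .
  then have "vs \<noteq> []" using * assms(3) by auto
  then obtain j u h y m q where p: "j < length sys" "b = u + h + y" "l = m + q" "(h, m) \<in> L j"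
      "l \<le> length vs * m" "\<nu> u \<le> 16 * K * q" "length vs \<le> q + 1"
      "\<And>h' m'. (h', m') \<in> L j \<Longrightarrow> (u + h' + y, m' + q) \<in> supp (factors vs)"
    using largest_factor[of vs b l, OF _ _ _ *(3)] monomial_proper(1)[OF mon] monomial_coeffs(2)[OF mon]
    by metis
  have "0 < q + k"
    using monomial_proper(2)[OF mon] p(7) by (cases "length vs \<le> 1") auto
  have "occurs (i, g, n) (j, h, m)"
    unfolding occurs_def prod.case
  proof (intro exI conjI allI impI)
    show "g = a + u + h + y" "n = m + (q + k)" using * p by (simp_all add: add.assoc)
    have "\<nu> (a + u) \<le> K + 16 * K * q"
      using nu_add[of a u] p(6) monomial_coeffs(1)[OF mon *(2)] by simp
    moreover have "K * 1 \<le> K * (q + k)" using \<open>0 < q + k\<close> by (intro mult_le_mono2) linarith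
    ultimately show "\<nu> (a + u) \<le> 24 * K * (q + k)" by (simp add: algebra_simps)
    fix h' m' assume "(h', m') \<in> L j"
    then have "(a + (u + h' + y), m' + q + k) \<in> L i"
      using L_iff[OF assms(1)] p(8) * by blast
    then show "(a + u + h' + y, m' + (q + k)) \<in> L i" by (simp add: add.assoc)
  qed
  moreover have "n \<le> B * m + B"
    using p(5) *(5) len mult_le_mono1[of "length vs" B m] by linarith
  moreover have "m < n" using * p \<open>0 < q + k\<close> by simp
  ultimately show ?thesis using p by blast
qed

text \<open>Since the largest factor has at least a fixed fraction of the length, descending to it repeatedly
  cannot jump over the window from \<open>N\<close> to \<open>B * N + B\<close>.\<close>

lemma occurrence_of_bounded_size:
  assumes "i < length sys" "(g, n) \<in> L i" "N \<le> n" "B \<le> N"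
  shows "\<exists>j h m. j < length sys \<and> (h, m) \<in> L j \<and> occurs (i, g, n) (j, h, m) \<and> N \<le> m \<and> m \<le> B * N + B"
  using assms
proof (induction n arbitrary: i g rule: less_induct)
  case (less n)
  show ?case
  proof (cases "n \<le> B * N + B")
    case True
    then show ?thesis using less.prems occurs_refl by blast
  next
    case False
    have "B \<le> n" using less.prems by simp
    then obtain j h m where s: "j < length sys" "(h, m) \<in> L j" "occurs (i, g, n) (j, h, m)"
        "m < n" "n \<le> B * m + B"
      using smaller_occurrence less.prems by blast
    then have "B * N < B * m" using False by linarith
    then have "N \<le> m" by simp
    then show ?thesis using less.IH[OF s(4,1,2) _ less.prems(4)] s(3) occurs_trans by blast
  qed
qed

primrec threshold :: "nat \<Rightarrow> nat" where
  "threshold 0 = B"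
| "threshold (Suc r) = B * threshold r + B"

lemma threshold_ge: "B \<le> threshold r"
  by (cases r) simp_all

text \<open>The lengths along such a descent shrink at most by the factor \<open>B\<close> (and the term \<open>B\<close>) at every step, so
  a node that is longer than the threshold has a descending chain of \<open>r\<close> proper descendants.\<close>

lemma occurrence_chain:
  assumes "i < length sys" "(g, n) \<in> L i" "threshold r \<le> n"
  shows "\<exists>t. t 0 = (i, g, n) \<and>
    (\<forall>a\<le>r. fst (t a) < length sys \<and> snd (t a) \<in> L (fst (t a))) \<and>
    (\<forall>a b. a < b \<longrightarrow> b \<le> r \<longrightarrow> occurs (t a) (t b) \<and> snd (snd (t b)) < snd (snd (t a)))"
  using assms
proof (induction r arbitrary: i g n)
  case 0
  then show ?case by (intro exI[of _ "\<lambda>_. (i, g, n)"]) auto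
next
  case (Suc r)
  have "B \<le> n" using Suc.prems by simp
  then obtain j h m where s: "j < length sys" "(h, m) \<in> L j" "occurs (i, g, n) (j, h, m)"
      "m < n" "n \<le> B * m + B"
    using smaller_occurrence Suc.prems by blast
  have "0 < B" by (simp add: B_def)
  have "B * threshold r \<le> B * m" using s(5) Suc.prems(3) unfolding threshold.simps by linarith
  then have "threshold r \<le> m" using nat_mult_le_cancel1[OF \<open>0 < B\<close>] by blast
  then obtain t where t: "t 0 = (j, h, m)"
      "\<And>a. a \<le> r \<Longrightarrow> fst (t a) < length sys \<and> snd (t a) \<in> L (fst (t a))"
      "\<And>a b. a < b \<Longrightarrow> b \<le> r \<Longrightarrow> occurs (t a) (t b) \<and> snd (snd (t b)) < snd (snd (t a))"
    using Suc.IH[OF s(1,2)] by blast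
  define t' where "t' = case_nat (i, g, n) t"
  have first: "occurs (i, g, n) (t b) \<and> snd (snd (t b)) < n" if "b \<le> r" for b
    using t(3)[of 0 b] that s(3,4) t(1) occurs_trans by (cases "b = 0") fastforce+
  show ?case
  proof (intro exI[of _ t'] conjI allI impI)
    fix a b assume "a < b" "b \<le> Suc r"
    then show "occurs (t' a) (t' b)" "snd (snd (t' b)) < snd (snd (t' a))"
      using t(3) first by (cases a; cases b; simp add: t'_def)+
  next
    fix a assume "a \<le> Suc r"
    then show "fst (t' a) < length sys" "snd (t' a) \<in> L (fst (t' a))"
      using t(2) Suc.prems by (cases a; simp add: t'_def)+
  qed (simp add: t'_def)
qed

end

text \<open>First descend to a node of bounded length that is still long enough for a chain with more nodes than
  there are variables; two nodes of the chain have the same variable. As the pump lies inside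
  a node of bounded length, only finitely many elements occur as \<open>w\<close>, \<open>v w x\<close> and \<open>v v w x x\<close>.\<close>

lemma pumping:
  fixes f :: "('g::group_add \<Rightarrow>\<^sub>0 nat) fps" and \<nu> :: "'g \<Rightarrow> nat"
  assumes "algebraic_series f" and nu: "\<And>a b. \<nu> (a + b) \<le> \<nu> a + \<nu> b" "\<nu> 0 = 0"
  obtains N C :: nat and E :: "'g set" where "finite E"
    and "\<And>g n. g \<in> keys (fps_nth f n) \<Longrightarrow> N \<le> n \<Longrightarrow>
      \<exists>u v w x y p. 0 < p \<and> p \<le> n \<and> g = u + (v + w + x) + y \<and> \<nu> u \<le> C * n \<and>
        w \<in> E \<and> v + w + x \<in> E \<and> v + (v + w + x) + x \<in> E \<and>
        (\<forall>k. n - p + k * p > 0 \<and> u + ((\<lambda>h. v + h + x) ^^ k) w + y \<in> keys (fps_nth f (n - p + k * p)))"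
proof -
  obtain sys F where F: "sys \<noteq> []" "proper_system sys" "proper_solution sys F" "F ! 0 = proper_part f"
    using assms(1) by (auto simp: algebraic_series_def)
  interpret algebraic_grammar sys F \<nu>
    by unfold_locales (use F nu in auto)
  have zero: "(g, n) \<in> L 0 \<longleftrightarrow> 0 < n \<and> g \<in> keys (fps_nth f n)" for g n
    by (auto simp: L_def in_supp F(4) proper_part_def)
  define N where "N = threshold (length sys)"
  define E where "E = (\<Union>i<length sys. \<Union>n\<le>2 * (B * N + B). keys (fps_nth (F ! i) n))"
  have E: "h \<in> E" if "(h, m) \<in> L i" "i < length sys" "m \<le> 2 * (B * N + B)" for h m i
    using that by (auto simp: E_def L_def in_supp)
  have "B \<le> N" using threshold_ge by (simp add: N_def)
  have "0 < B" by (simp add: B_def)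
  show thesis
  proof (rule that[of E N "24 * K"])
    show "finite E" by (simp add: E_def)
    fix g n assume "g \<in> keys (fps_nth f n)" "N \<le> n"
    then have "(g, n) \<in> L 0" "0 < length sys" using zero \<open>B \<le> N\<close> \<open>0 < B\<close> F(1) by auto
    then obtain j h m where d: "j < length sys" "(h, m) \<in> L j" "occurs (0, g, n) (j, h, m)"
        "N \<le> m" "m \<le> B * N + B"
      using occurrence_of_bounded_size \<open>N \<le> n\<close> \<open>B \<le> N\<close> by blast
    then obtain t where t: "t 0 = (j, h, m)"
      "\<And>a. a \<le> length sys \<Longrightarrow> fst (t a) < length sys \<and> snd (t a) \<in> L (fst (t a))"
      "\<And>a b. a < b \<Longrightarrow> b \<le> length sys \<Longrightarrow> occurs (t a) (t b) \<and> snd (snd (t b)) < snd (snd (t a))"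
      using occurrence_chain[OF d(1,2), of "length sys"] unfolding N_def by metis
    have "\<not> inj_on (fst \<circ> t) {..length sys}"
    proof (rule pigeonhole)
      have "(fst \<circ> t) ` {..length sys} \<subseteq> {..<length sys}" using t(2) by auto
      then have "card ((fst \<circ> t) ` {..length sys}) \<le> card {..<length sys}"
        by (intro card_mono) auto
      then show "card ((fst \<circ> t) ` {..length sys}) < card {..length sys}" by simp
    qed
    then obtain a b where ab: "a < b" "b \<le> length sys" "fst (t a) = fst (t b)"
      by (fastforce simp: inj_on_def neq_iff)
    obtain i h1 m1 h2 m2 where i: "t a = (i, h1, m1)" "t b = (i, h2, m2)"
      using ab(3) by (metis prod.collapse)
    have L12: "i < length sys" "(h1, m1) \<in> L i" "(h2, m2) \<in> L i"
      using t(2)[of a] t(2)[of b] ab i by auto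
    have "occurs (t a) (t b)" "m2 < m1" using t(3)[OF ab(1,2)] i by auto
    then obtain v x p where p: "h1 = v + h2 + x" "m1 = m2 + p"
        "\<And>h' m'. (h', m') \<in> L i \<Longrightarrow> (v + h' + x, m' + p) \<in> L i"
      by (auto simp: occurs_def i)
    have "m1 \<le> m" using t(1) t(3)[of 0 a] ab i by (cases "a = 0") auto
    have "occurs (j, h, m) (t a)"
      using t(1) t(3)[of 0 a] ab occurs_refl by (cases "a = 0") auto
    then have "occurs (0, g, n) (i, h1, m1)" using d(3) occurs_trans i(1) by metis
    then obtain u y q where c: "g = u + h1 + y" "n = m1 + q" "\<nu> u \<le> 24 * K * q"
        "\<And>h' m'. (h', m') \<in> L i \<Longrightarrow> (u + h' + y, m' + q) \<in> L 0"
      by (auto simp: occurs_def)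
    have iter: "(((\<lambda>h. v + h + x) ^^ k) h2, m2 + k * p) \<in> L i" for k
    proof (induction k)
      case (Suc k)
      have "m2 + Suc k * p = m2 + k * p + p" by simp
      moreover have "((\<lambda>h. v + h + x) ^^ Suc k) h2 = v + ((\<lambda>h. v + h + x) ^^ k) h2 + x"
        by simp
      ultimately show ?case using p(3)[OF Suc] by presburger
    qed (use L12(3) in simp)
    have pump: "(u + ((\<lambda>h. v + h + x) ^^ k) h2 + y, n - p + k * p) \<in> L 0" for k
      using c(4)[OF iter[of k]] p(2) c(2) by (simp add: algebra_simps)
    have "0 < p" "p \<le> n" using p(2) c(2) \<open>m2 < m1\<close> by auto
    show "\<exists>u v w x y p. 0 < p \<and> p \<le> n \<and> g = u + (v + w + x) + y \<and> \<nu> u \<le> 24 * K * n \<and>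
        w \<in> E \<and> v + w + x \<in> E \<and> v + (v + w + x) + x \<in> E \<and>
        (\<forall>k. n - p + k * p > 0 \<and> u + ((\<lambda>h. v + h + x) ^^ k) w + y \<in> keys (fps_nth f (n - p + k * p)))"
    proof (intro exI conjI allI)
      show "0 < p" "p \<le> n" by fact+
      show "g = u + (v + h2 + x) + y" using c p by simp
      show "\<nu> u \<le> 24 * K * n" using c(2,3) by (simp add: algebra_simps)
      show "h2 \<in> E" "v + h2 + x \<in> E" "v + (v + h2 + x) + x \<in> E"
        using E[OF L12(3,1)] E[OF p(3)[OF L12(3)] L12(1)] E[OF p(3)[OF p(3)[OF L12(3)]] L12(1)]
          \<open>m1 \<le> m\<close> d(5) p(2) by auto
      show "n - p + k * p > 0" "u + ((\<lambda>h. v + h + x) ^^ k) h2 + y \<in> keys (fps_nth f (n - p + k * p))" for k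
        using iffD1[OF zero pump[of k]] by (rule conjunct1, rule conjunct2)
    qed
  qed
qed


section \<open>Coordinates on the Heisenberg group\<close>

definition letter_x :: "letter \<Rightarrow> int" where
  "letter_x l = (if fst l = X then if snd l then 1 else -1 else 0)"

definition letter_y :: "letter \<Rightarrow> int" where
  "letter_y l = (if fst l = Y then if snd l then 1 else -1 else 0)"

definition word_x :: "letter list \<Rightarrow> int" where "word_x w = (\<Sum>l\<leftarrow>w. letter_x l)"
definition word_y :: "letter list \<Rightarrow> int" where "word_y w = (\<Sum>l\<leftarrow>w. letter_y l)"

text \<open>Twice the signed area between the path of the word in the plane and its chord.\<close>

primrec word_q :: "letter list \<Rightarrow> int" where
  "word_q [] = 0"
| "word_q (l # w) = word_q w + letter_x l * word_y w - letter_y l * word_x w"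

lemma word_x_append: "word_x (u @ v) = word_x u + word_x v"
  by (simp add: word_x_def)

lemma word_y_append: "word_y (u @ v) = word_y u + word_y v"
  by (simp add: word_y_def)

lemma word_q_append: "word_q (u @ v) = word_q u + word_q v + word_x u * word_y v - word_y u * word_x v"
  by (induction u) (simp_all add: word_x_append word_y_append, simp_all add: word_x_def word_y_def algebra_simps)

lemma heis_rel_coordinates:
  "heis_rel u v \<Longrightarrow> word_x u = word_x v \<and> word_y u = word_y v \<and> word_q u = word_q v"
proof (induction rule: heis_rel.induct)
  case (cancel l)
  then show ?case by (simp add: word_x_def word_y_def letter_x_def letter_y_def inv_letter_def)
next
  case (central l)
  then show ?case
    by (simp add: comm_word_def word_x_def word_y_def letter_x_def letter_y_def algebra_simps)
qed (simp_all add: word_x_append word_y_append word_q_append)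

lift_definition hx :: "heis \<Rightarrow> int" is word_x by (simp add: heis_rel_coordinates)
lift_definition hy :: "heis \<Rightarrow> int" is word_y by (simp add: heis_rel_coordinates)
lift_definition hq :: "heis \<Rightarrow> int" is word_q by (simp add: heis_rel_coordinates)

lemma hx_add [simp]: "hx (g + h) = hx g + hx h"
  by transfer (rule word_x_append)

lemma hy_add [simp]: "hy (g + h) = hy g + hy h"
  by transfer (rule word_y_append)

lemma hq_add: "hq (g + h) = hq g + hq h + (hx g * hy h - hy g * hx h)"
  by transfer (simp add: word_q_append)

lemma h_zero [simp]: "hx 0 = 0" "hy 0 = 0" "hq 0 = 0"
  by (transfer, simp add: word_x_def word_y_def)+

lemma hx_minus [simp]: "hx (- g) = - hx g"
  using hx_add[of g "- g"] by (simp del: hx_add)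

lemma hy_minus [simp]: "hy (- g) = - hy g"
  using hy_add[of g "- g"] by (simp del: hy_add)

lemma hq_minus [simp]: "hq (- g) = - hq g"
  using hq_add[of g "- g"] by (simp add: algebra_simps)

lift_definition gx :: heis is "[(X, True)]" .
lift_definition gy :: heis is "[(Y, True)]" .
lift_definition gz :: heis is comm_word .

lemma h_generators [simp]:
  "hx gx = 1" "hy gx = 0" "hq gx = 0" "hx gy = 0" "hy gy = 1" "hq gy = 0" "hx gz = 0" "hy gz = 0" "hq gz = 2"
  by (transfer, simp add: word_x_def word_y_def letter_x_def letter_y_def comm_word_def)+

lemma minus_gx: "- gx = abs_heis [(X, False)]"
  by (simp add: gx_def uminus_heis.abs_eq inv_word_def inv_letter_def)

lemma minus_gy: "- gy = abs_heis [(Y, False)]"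
  by (simp add: gy_def uminus_heis.abs_eq inv_word_def inv_letter_def)

lemma gz_eq: "gz = gx + gy + - gx + - gy"
  unfolding minus_gx minus_gy by (simp add: gx_def gy_def gz_def plus_heis.abs_eq comm_word_def)

lemma gz_central: "gz + g = g + gz"
proof (transfer)
  show "heis_rel (comm_word @ w) (w @ comm_word)" for w
  proof (induction w)
    case Nil
    show ?case by (simp add: heis_rel.refl)
  next
    case (Cons l w)
    have "heis_rel ((comm_word @ [l]) @ w) ((l # comm_word) @ w)"
      by (intro heis_rel.append heis_rel.central heis_rel.refl)
    moreover have "heis_rel ([l] @ (comm_word @ w)) ([l] @ (w @ comm_word))"
      by (intro heis_rel.append Cons heis_rel.refl)
    ultimately show ?case using heis_rel.trans by fastforce
  qed
qed

text \<open>The integer powers of \<open>g\<close>.\<close>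

definition pw :: "'g::group_add \<Rightarrow> int \<Rightarrow> 'g" where
  "pw g n = (if 0 \<le> n then ((+) g ^^ nat n) 0 else ((+) (- g) ^^ nat (- n)) 0)"

lemma pw_0 [simp]: "pw g 0 = 0"
  by (simp add: pw_def)

lemma pw_succ: "pw g (n + 1) = g + pw g n"
proof (cases "0 \<le> n")
  case True
  then have "nat (n + 1) = Suc (nat n)" by simp
  then show ?thesis using True by (simp add: pw_def)
next
  case False
  then have "nat (- n) = Suc (nat (- (n + 1)))" by simp
  then have "pw g n = - g + ((+) (- g) ^^ nat (- (n + 1))) 0" using False by (simp add: pw_def)
  moreover have "pw g (n + 1) = ((+) (- g) ^^ nat (- (n + 1))) 0" using False by (simp add: pw_def)
  ultimately show ?thesis by (simp add: add.assoc[symmetric])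
qed

lemma pw_pred: "pw g (n - 1) = - g + pw g n"
  using pw_succ[of g "n - 1"] by (simp add: add.assoc[symmetric])

lemma pw_add: "pw g (m + n) = pw g m + pw g n"
proof (induction m rule: int_induct[of _ 0])
  case (step1 m)
  then show ?case using pw_succ[of g m] pw_succ[of g "m + n"] by (simp add: add.assoc algebra_simps)
next
  case (step2 m)
  have "pw g (m - 1 + n) = pw g (m + n - 1)" by (simp add: algebra_simps)
  also have "\<dots> = - g + (pw g m + pw g n)" by (simp only: pw_pred step2)
  also have "\<dots> = pw g (m - 1) + pw g n" by (simp only: pw_pred add.assoc)
  finally show ?case .
qed simp

lemma pw_1 [simp]: "pw g 1 = g" and pw_minus_1: "pw g (- 1) = - g"
  using pw_succ[of g 0] pw_pred[of g 0] by simp_all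

lemma hx_pw [simp]: "hx (pw g n) = n * hx g"
  by (induction n rule: int_induct[of _ 0]) (simp_all add: pw_succ pw_pred algebra_simps)

lemma hy_pw [simp]: "hy (pw g n) = n * hy g"
  by (induction n rule: int_induct[of _ 0]) (simp_all add: pw_succ pw_pred algebra_simps)

lemma hq_pw [simp]: "hq (pw g n) = n * hq g"
  by (induction n rule: int_induct[of _ 0]) (simp_all add: pw_succ pw_pred hq_add algebra_simps)

lemma pw_gz_central: "pw gz n + h = h + pw gz n"
proof -
  have minus: "- gz + k = k + - gz" for k
  proof -
    have "- gz + k = - gz + ((k + gz) + - gz)" by (simp only: add.assoc add.right_inverse add_0_right)
    also have "\<dots> = - gz + ((gz + k) + - gz)" by (simp only: gz_central)
    also have "\<dots> = k + - gz" by (simp only: add.assoc[symmetric] add.left_inverse add_0_left)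
    finally show ?thesis .
  qed
  show ?thesis
  proof (induction n rule: int_induct[of _ 0])
    case (step1 n)
    have "pw gz (n + 1) + h = gz + h + pw gz n" by (simp only: pw_succ add.assoc step1)
    also have "\<dots> = h + pw gz (n + 1)" by (simp only: gz_central pw_succ add.assoc)
    finally show ?case .
  next
    case (step2 n)
    have "pw gz (n - 1) + h = - gz + h + pw gz n" by (simp only: pw_pred add.assoc step2)
    also have "\<dots> = h + pw gz (n - 1)" by (simp only: minus pw_pred add.assoc)
    finally show ?case .
  qed simp
qed

lemma gy_pw_gx: "gy + pw gx i = pw gx i + gy + pw gz (- i)"
proof (induction i rule: int_induct[of _ 0])
  case (step1 i)
  have "pw gz 1 + (gy + gx) = gx + gy"
    by (simp only: pw_1 gz_eq add.assoc minus_add_cancel add.left_inverse add_0_right)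
  then have "gy + gx = pw gz (- 1) + (gx + gy)"
    by (metis add.assoc add_0_left add.left_inverse pw_1 pw_minus_1)
  then have 1: "gy + gx = gx + gy + pw gz (- 1)" by (simp only: pw_gz_central)
  have "gy + pw gx (i + 1) = (gy + gx) + pw gx i" by (simp only: pw_succ add.assoc)
  also have "\<dots> = gx + gy + (pw gz (- 1) + pw gx i)" by (simp only: 1 add.assoc)
  also have "\<dots> = gx + (gy + pw gx i) + pw gz (- 1)" by (simp only: pw_gz_central add.assoc)
  also have "\<dots> = pw gx (i + 1) + gy + (pw gz (- i) + pw gz (- 1))" by (simp only: step1 pw_succ add.assoc)
  also have "pw gz (- i) + pw gz (- 1) = pw gz (- (i + 1))" by (simp add: pw_add[symmetric])
  finally show ?case .
next
  case (step2 i)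
  have "- gx + gz + gy = gy + - gx"
    by (simp only: gz_eq add.assoc minus_add_cancel add.left_inverse add_0_right)
  then have 1: "gy + - gx = - gx + gy + pw gz 1"
    by (simp only: add.assoc gz_central pw_1)
  have "gy + pw gx (i - 1) = (gy + - gx) + pw gx i" by (simp only: pw_pred add.assoc)
  also have "\<dots> = - gx + gy + (pw gz 1 + pw gx i)" by (simp only: 1 add.assoc)
  also have "\<dots> = - gx + (gy + pw gx i) + pw gz 1" by (simp only: pw_gz_central add.assoc)
  also have "\<dots> = pw gx (i - 1) + gy + (pw gz (- i) + pw gz 1)" by (simp only: step2 pw_pred add.assoc)
  also have "pw gz (- i) + pw gz 1 = pw gz (- (i - 1))" by (simp add: pw_add[symmetric] del: pw_1)
  finally show ?case .
qed simp

lemma minus_gy_pw_gx: "- gy + pw gx i = pw gx i + - gy + pw gz i"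
proof -
  have "gy + (pw gx i + - gy + pw gz i) = (gy + pw gx i) + - gy + pw gz i" by (simp only: add.assoc)
  also have "\<dots> = pw gx i + gy + (pw gz (- i) + - gy) + pw gz i" by (simp only: gy_pw_gx add.assoc)
  also have "\<dots> = pw gx i + (gy + - gy) + (pw gz (- i) + pw gz i)"
    by (simp only: pw_gz_central[of "- i" "- gy"] add.assoc)
  also have "\<dots> = pw gx i" by (simp add: pw_add[symmetric])
  finally show ?thesis by (metis minus_add_cancel)
qed

lemma normal_form: "\<exists>i j k. g = pw gx i + pw gy j + pw gz k"
proof -
  have "\<exists>i j k. abs_heis w = pw gx i + pw gy j + pw gz k" for w
  proof (induction w)
    case Nil
    have "abs_heis [] = pw gx 0 + pw gy 0 + pw gz 0" by (simp add: zero_heis_def plus_heis.abs_eq)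
    then show ?case by blast
  next
    case (Cons l w)
    then obtain i j k where w: "abs_heis w = pw gx i + pw gy j + pw gz k" by blast
    have l: "abs_heis (l # w) = abs_heis [l] + abs_heis w" by (simp add: plus_heis.abs_eq)
    obtain a b where ab: "l = (a, b)" by (cases l)
    consider "abs_heis [l] = gx" | "abs_heis [l] = - gx" | "abs_heis [l] = gy" | "abs_heis [l] = - gy"
      unfolding ab using minus_gx minus_gy gx_def gy_def by (cases a; cases b) auto
    then show ?case
    proof cases
      case 1
      then have "abs_heis (l # w) = pw gx (i + 1) + pw gy j + pw gz k"
        by (simp only: l w pw_succ add.assoc)
      then show ?thesis by blast
    next
      case 2
      then have "abs_heis (l # w) = pw gx (i - 1) + pw gy j + pw gz k"
        by (simp only: l w pw_pred add.assoc)
      then show ?thesis by blast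
    next
      case 3
      have "abs_heis (l # w) = (gy + pw gx i) + pw gy j + pw gz k" using 3 by (simp only: l w add.assoc)
      also have "\<dots> = pw gx i + gy + (pw gz (- i) + pw gy j) + pw gz k"
        by (simp only: gy_pw_gx add.assoc)
      also have "\<dots> = pw gx i + (gy + pw gy j) + (pw gz (- i) + pw gz k)"
        by (simp only: pw_gz_central[of "- i" "pw gy j"] add.assoc)
      also have "gy + pw gy j = pw gy (j + 1)" by (simp only: pw_succ)
      also have "pw gz (- i) + pw gz k = pw gz (k - i)" by (simp add: pw_add[symmetric])
      finally show ?thesis by blast
    next
      case 4
      have "abs_heis (l # w) = (- gy + pw gx i) + pw gy j + pw gz k" using 4 by (simp only: l w add.assoc)
      also have "\<dots> = pw gx i + - gy + (pw gz i + pw gy j) + pw gz k"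
        by (simp only: minus_gy_pw_gx add.assoc)
      also have "\<dots> = pw gx i + (- gy + pw gy j) + (pw gz i + pw gz k)"
        by (simp only: pw_gz_central[of i "pw gy j"] add.assoc)
      also have "- gy + pw gy j = pw gy (j - 1)" by (simp only: pw_pred)
      also have "pw gz i + pw gz k = pw gz (k + i)" by (simp add: pw_add[symmetric] add.commute)
      finally show ?thesis by blast
    qed
  qed
  then show ?thesis by (induct g rule: heis.abs_induct) blast
qed

text \<open>The two displacements and the area of a normal form determine its three exponents.\<close>

lemma heis_eqI:
  assumes "hx g = hx h" "hy g = hy h" "hq g = hq h"
  shows "g = h"
proof -
  obtain i j k i' j' k' where *: "g = pw gx i + pw gy j + pw gz k" "h = pw gx i' + pw gy j' + pw gz k'"
    using normal_form by metis
  show ?thesis using assms unfolding * by (simp add: hq_add)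
qed


section \<open>Word length in the Heisenberg group\<close>

text \<open>The \<open>\<ell>\<^sup>1\<close> norm of the displacement.\<close>

definition n1 :: "heis \<Rightarrow> int" where "n1 g = \<bar>hx g\<bar> + \<bar>hy g\<bar>"

definition det :: "heis \<Rightarrow> heis \<Rightarrow> int" where "det g h = hx g * hy h - hy g * hx h"

definition comm :: "heis \<Rightarrow> heis \<Rightarrow> heis" where "comm g h = g + h + - g + - h"

lemma hq_add_det: "hq (g + h) = hq g + hq h + det g h"
  by (simp add: hq_add det_def)

lemma det_add: "det (a + b) c = det a c + det b c" "det c (a + b) = det c a + det c b"
  by (simp_all add: det_def algebra_simps)

lemma det_self [simp]: "det a a = 0" by (simp add: det_def)

lemma det_zero [simp]: "det 0 a = 0" "det a 0 = 0" by (simp_all add: det_def)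

lemma det_swap: "det b a = - det a b" by (simp add: det_def)

lemma det_le: "\<bar>det g h\<bar> \<le> n1 g * n1 h"
proof -
  have "\<bar>det g h\<bar> \<le> \<bar>hx g\<bar> * \<bar>hy h\<bar> + \<bar>hy g\<bar> * \<bar>hx h\<bar>"
    unfolding det_def by (metis abs_mult abs_triangle_ineq4)
  also have "\<dots> \<le> n1 g * n1 h"
    unfolding n1_def by (simp add: algebra_simps)
  finally show ?thesis .
qed

lemma n1_nonneg [simp]: "0 \<le> n1 g" by (simp add: n1_def)

lemma n1_add: "n1 (g + h) \<le> n1 g + n1 h"
  unfolding n1_def hx_add hy_add by linarith

lemma n1_minus [simp]: "n1 (- g) = n1 g" by (simp add: n1_def)

lemma n1_zero [simp]: "n1 0 = 0" by (simp add: n1_def)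

lemma hx_diff [simp]: "hx (g - h) = hx g - hx h"
  using hx_add[of g "- h"] by simp

lemma hy_diff [simp]: "hy (g - h) = hy g - hy h"
  using hy_add[of g "- h"] by simp

lemma hq_diff: "hq (g - h) = hq g - hq h - (hx g * hy h - hy g * hx h)"
  using hq_add[of g "- h"] by simp

lemma comm_eq: "comm g h = pw gz (det g h)"
  by (rule heis_eqI) (simp_all add: comm_def hq_add hq_diff det_def algebra_simps)

lemma discrete_intermediate_value:
  fixes f :: "nat \<Rightarrow> int"
  assumes "f 0 \<le> j" "j \<le> f i" "0 \<le> D" "\<And>t. t < i \<Longrightarrow> f (Suc t) \<le> f t + D"
  shows "\<exists>t\<le>i. f t \<le> j \<and> j \<le> f t + D"
  using assms
proof (induction i)
  case (Suc i)
  show ?case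
  proof (cases "j \<le> f i")
    case True
    then obtain t where "t \<le> i" "f t \<le> j" "j \<le> f t + D" using Suc by auto
    then show ?thesis using le_SucI by blast
  next
    case False
    then show ?thesis using Suc.prems by (intro exI[of _ i]) force
  qed
qed auto

locale heis_generators =
  fixes S :: "heis set"
  assumes finite_S: "finite S" and symmetric_S: "symmetric S" and generates_S: "generates S"
begin

abbreviation wl :: "heis \<Rightarrow> nat" where "wl \<equiv> word_length S"

lemma minus_sum_list: "- sum_list w = sum_list (rev (map uminus (w :: heis list)))"
  by (induction w) (simp_all add: minus_add)

lemma uminus_words: "set w \<subseteq> S \<Longrightarrow> set (map uminus w) \<subseteq> S"
  using symmetric_S by (auto simp: symmetric_def)

lemma word_exists: "\<exists>w. set w \<subseteq> S \<and> sum_list w = g"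
proof -
  let ?H = "{sum_list w | w. set w \<subseteq> S}"
  have "is_subgroup ?H"
    unfolding is_subgroup_def
  proof (intro conjI ballI)
    show "0 \<in> ?H" by (auto intro!: exI[of _ "[]"])
    fix g assume "g \<in> ?H"
    then obtain w where w: "set w \<subseteq> S" "g = sum_list w" by auto
    then show "- g \<in> ?H"
      using uminus_words[of w] minus_sum_list by (auto intro!: exI[of _ "rev (map uminus w)"])
    fix h assume "h \<in> ?H"
    then obtain w' where "set w' \<subseteq> S" "h = sum_list w'" by auto
    then show "g + h \<in> ?H" using w by (auto intro!: exI[of _ "w @ w'"])
  qed
  moreover have "S \<subseteq> ?H"
  proof
    fix s assume "s \<in> S"
    then show "s \<in> ?H" by (auto intro!: exI[of _ "[s]"])
  qed
  ultimately have "?H = UNIV" using generates_S by (auto simp: generates_def)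
  then have "g \<in> ?H" by simp
  then show ?thesis by blast
qed

lemma geodesic_word:
  obtains w where "set w \<subseteq> S" "length w = wl g" "sum_list w = g"
proof -
  have "\<exists>n w. set w \<subseteq> S \<and> length w = n \<and> sum_list w = g" using word_exists by blast
  then have "\<exists>w. set w \<subseteq> S \<and> length w = wl g \<and> sum_list w = g"
    unfolding word_length_def by (rule LeastI_ex)
  then show thesis using that by blast
qed

lemma wl_le: "set w \<subseteq> S \<Longrightarrow> wl (sum_list w) \<le> length w"
  unfolding word_length_def by (rule Least_le) blast

lemma wl_add: "wl (g + h) \<le> wl g + wl h"
proof -
  obtain v w where "set v \<subseteq> S" "length v = wl g" "sum_list v = g"
      "set w \<subseteq> S" "length w = wl h" "sum_list w = h"
    by (metis geodesic_word)
  then show ?thesis using wl_le[of "v @ w"] by simp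
qed

lemma wl_minus_le: "wl (- g) \<le> wl g"
proof -
  obtain w where "set w \<subseteq> S" "length w = wl g" "sum_list w = g" by (metis geodesic_word)
  then show ?thesis
    using wl_le[of "rev (map uminus w)"] uminus_words[of w] by (simp add: minus_sum_list[symmetric])
qed

lemma wl_minus [simp]: "wl (- g) = wl g"
  using wl_minus_le[of g] wl_minus_le[of "- g"] by simp

lemma wl_0 [simp]: "wl 0 = 0"
  using wl_le[of "[]"] by simp

lemma wl_pw: "wl (pw g n) \<le> nat \<bar>n\<bar> * wl g"
proof (induction n rule: int_induct[of _ 0])
  case (step1 i)
  then have "wl (pw g (i + 1)) \<le> wl g + nat \<bar>i\<bar> * wl g"
    using wl_add[of g "pw g i"] by (simp add: pw_succ)
  also have "\<dots> = nat \<bar>i + 1\<bar> * wl g" using step1 by (simp add: nat_add_distrib)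
  finally show ?case .
next
  case (step2 i)
  then have "wl (pw g (i - 1)) \<le> wl g + nat \<bar>i\<bar> * wl g"
    using wl_add[of "- g" "pw g i"] by (simp add: pw_pred)
  also have "\<dots> = Suc (nat \<bar>i\<bar>) * wl g" by simp
  also have "Suc (nat \<bar>i\<bar>) = nat \<bar>i - 1\<bar>" using step2 by linarith
  finally show ?case .
qed simp

lemma wl_comm: "wl (comm g h) \<le> 2 * wl g + 2 * wl h"
  using wl_add[of "g + h + - g" "- h"] wl_add[of "g + h" "- g"] wl_add[of g h] by (simp add: comm_def)

lemma finite_sphere: "finite {g. wl g = n}"
proof (rule finite_subset)
  show "{g. wl g = n} \<subseteq> sum_list ` {w. set w \<subseteq> S \<and> length w = n}"
    using geodesic_word by (smt (verit, best) image_eqI mem_Collect_eq subsetI)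
  show "finite (sum_list ` {w. set w \<subseteq> S \<and> length w = n})"
    using finite_lists_length_eq[OF finite_S] by simp
qed

definition K :: int where "K = 1 + (\<Sum>s\<in>S. n1 s + \<bar>hq s\<bar>)"

lemma K_pos: "1 \<le> K" unfolding K_def by (simp add: sum_nonneg)

lemma letter_bounds: "s \<in> S \<Longrightarrow> n1 s \<le> K" "s \<in> S \<Longrightarrow> \<bar>hq s\<bar> \<le> K"
proof -
  assume "s \<in> S"
  then have "n1 s + \<bar>hq s\<bar> \<le> (\<Sum>s\<in>S. n1 s + \<bar>hq s\<bar>)" using finite_S by (intro member_le_sum) auto
  then show "n1 s \<le> K" "\<bar>hq s\<bar> \<le> K" unfolding K_def using n1_nonneg[of s] by linarith+
qed

lemma n1_word: "set w \<subseteq> S \<Longrightarrow> n1 (sum_list w) \<le> K * int (length w)"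
proof (induction w)
  case (Cons s w)
  then show ?case using n1_add[of s "sum_list w"] letter_bounds(1)[of s] by (simp add: algebra_simps)
qed simp

text \<open>A path that stays in a ball of radius \<open>Q\<close> sweeps out at most \<open>O(Q)\<close> area per letter.\<close>

lemma hq_word_prefixes:
  assumes "set w \<subseteq> S" "0 \<le> Q" "\<And>i. i \<le> length w \<Longrightarrow> n1 (sum_list (take i w)) \<le> Q"
  shows "\<bar>hq (sum_list w)\<bar> \<le> int (length w) * (K * (1 + Q))"
  using assms
proof (induction w rule: rev_induct)
  case (snoc s w)
  have IH: "\<bar>hq (sum_list w)\<bar> \<le> int (length w) * (K * (1 + Q))"
  proof (rule snoc.IH)
    show "n1 (sum_list (take i w)) \<le> Q" if "i \<le> length w" for i
      using snoc.prems(3)[of i] that by simp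
  qed (use snoc.prems in auto)
  have "n1 (sum_list w) \<le> Q" using snoc.prems(3)[of "length w"] by simp
  moreover have "n1 s \<le> K" "\<bar>hq s\<bar> \<le> K" using letter_bounds snoc.prems by auto
  ultimately have "\<bar>det (sum_list w) s\<bar> \<le> Q * K"
    using det_le[of "sum_list w" s] mult_mono[of "n1 (sum_list w)" Q "n1 s" K] snoc.prems(2) by simp
  then show ?case using IH \<open>\<bar>hq s\<bar> \<le> K\<close> by (simp add: hq_add_det algebra_simps)
qed simp

lemma hq_word:
  assumes "set w \<subseteq> S"
  shows "\<bar>hq (sum_list w)\<bar> \<le> int (length w) * (K * (1 + K * int (length w)))"
proof (rule hq_word_prefixes[OF assms])
  fix i assume "i \<le> length w"
  have "n1 (sum_list (take i w)) \<le> K * int (length (take i w))"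
    using assms set_take_subset by (intro n1_word) fast
  also have "\<dots> \<le> K * int (length w)" using K_pos by (intro mult_left_mono) auto
  finally show "n1 (sum_list (take i w)) \<le> K * int (length w)" .
qed (use K_pos in simp)

lemma hq_wl: "\<bar>hq g\<bar> \<le> int (wl g) * (K * (1 + K * int (wl g)))"
  by (metis geodesic_word hq_word)

text \<open>An area of size at most \<open>T\<^sup>2\<close> is the sum of a rectangle with sides at most \<open>T\<close> and of a rectangle of width
  \<open>1\<close>, that is, a central element is the product of two commutators of short elements.\<close>

lemma wl_upper_bound:
  obtains C :: nat where "\<And>g r. \<bar>hq g\<bar> \<le> int r ^ 2 \<Longrightarrow> int (wl g) \<le> int C * (n1 g + int r + 1)"
proof
  let ?c = "wl gx + wl gy"
  have central: "wl (pw gz k) \<le> 8 * ?c * T" if "\<bar>k\<bar> \<le> int T ^ 2" "0 < T" for k T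
  proof -
    let ?m = "k div int T" and ?r = "k mod int T"
    have r: "0 \<le> ?r" "?r < int T" using that(2) by auto
    have m: "\<bar>?m\<bar> \<le> int T"
    proof -
      have "?m \<le> (int T * int T) div int T" using that by (intro zdiv_mono1) (auto simp: power2_eq_square)
      moreover have "- (int T * int T) div int T \<le> ?m"
        using that by (intro zdiv_mono1) (auto simp: power2_eq_square)
      moreover have "- (int T * int T) div int T = - int T"
        using that(2) nonzero_mult_div_cancel_right[of "int T" "- int T"] by simp
      ultimately show ?thesis using that(2) by simp
    qed
    have "pw gz k = comm (pw gx (int T)) (pw gy ?m) + comm gx (pw gy ?r)"
      by (simp add: comm_eq det_def pw_add[symmetric])
    then have "wl (pw gz k) \<le> wl (comm (pw gx (int T)) (pw gy ?m)) + wl (comm gx (pw gy ?r))"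
      by (simp only: wl_add)
    also have "\<dots> \<le> (2 * wl (pw gx (int T)) + 2 * wl (pw gy ?m)) + (2 * wl gx + 2 * wl (pw gy ?r))"
      using wl_comm add_mono by blast
    also have "\<dots> \<le> (2 * (T * wl gx) + 2 * (T * wl gy)) + (2 * (T * wl gx) + 2 * (T * wl gy))"
    proof -
      have "wl (pw gx (int T)) \<le> T * wl gx" using wl_pw[of gx "int T"] by simp
      moreover have "wl (pw gy ?m) \<le> T * wl gy"
        using wl_pw[of gy ?m] m mult_le_mono1[of "nat \<bar>?m\<bar>" T "wl gy"] by linarith
      moreover have "wl (pw gy ?r) \<le> T * wl gy"
        using wl_pw[of gy ?r] r mult_le_mono1[of "nat \<bar>?r\<bar>" T "wl gy"] by linarith
      moreover have "1 * wl gx \<le> T * wl gx" using that(2) by (intro mult_le_mono1) simp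
      ultimately show ?thesis by linarith
    qed
    finally show ?thesis by (simp add: algebra_simps)
  qed
  fix g and r :: nat assume q: "\<bar>hq g\<bar> \<le> int r ^ 2"
  let ?T = "nat (n1 g) + r + 1"
  define k where "k = (hq g - hx g * hy g) div 2"
  obtain i j l where nf: "g = pw gx i + pw gy j + pw gz l" using normal_form by blast
  then have "hx g = i" "hy g = j" "hq g = i * j + 2 * l" by (simp_all add: hq_add)
  then have g: "g = pw gx (hx g) + pw gy (hy g) + pw gz k" using nf by (simp add: k_def)
  have "\<bar>hx g\<bar> * \<bar>hy g\<bar> \<le> n1 g * n1 g" unfolding n1_def by (intro mult_mono) auto
  then have "\<bar>hx g * hy g\<bar> \<le> n1 g ^ 2" by (simp add: abs_mult power2_eq_square)
  moreover have "2 * k = hq g - hx g * hy g" using \<open>hx g = i\<close> \<open>hy g = j\<close> \<open>hq g = i * j + 2 * l\<close> by (simp add: k_def)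
  ultimately have "\<bar>k\<bar> \<le> int r ^ 2 + n1 g ^ 2" using q by linarith
  also have "\<dots> \<le> int ?T ^ 2" by (simp add: power2_eq_square algebra_simps)
  finally have "wl (pw gz k) \<le> 8 * ?c * ?T" by (intro central) auto
  moreover have "wl (pw gx (hx g)) \<le> ?T * wl gx"
    using wl_pw[of gx "hx g"] mult_le_mono1[of "nat \<bar>hx g\<bar>" ?T "wl gx"] by (simp add: n1_def nat_add_distrib)
  moreover have "wl (pw gy (hy g)) \<le> ?T * wl gy"
    using wl_pw[of gy "hy g"] mult_le_mono1[of "nat \<bar>hy g\<bar>" ?T "wl gy"] by (simp add: n1_def nat_add_distrib)
  moreover have "wl g \<le> wl (pw gx (hx g)) + wl (pw gy (hy g)) + wl (pw gz k)"
    using wl_add[of "pw gx (hx g) + pw gy (hy g)" "pw gz k"] wl_add[of "pw gx (hx g)" "pw gy (hy g)"] g by simp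
  ultimately have "wl g \<le> 9 * ?c * ?T" by (simp add: algebra_simps)
  then have "int (wl g) \<le> int (9 * ?c * ?T)" by (simp only: of_nat_le_iff)
  then show "int (wl g) \<le> int (9 * ?c) * (n1 g + int r + 1)" by (simp add: distrib_left)
qed

text \<open>Conjugating a prefix \<open>P\<close> of a word by \<open>e\<^sup>n\<close> multiplies the element by the commutator of \<open>e\<^sup>n\<close> and
  \<open>P\<close>, which is central of size \<open>n * det e P\<close>. As the word has a large area, some prefix is far away from
  the origin, so that \<open>n = O(M)\<close> suffices to reach beyond \<open>M * L\<close>; by the intermediate value theorem a
  shorter prefix gives the desired central element up to an error of \<open>n * K\<close>. So an area of the order
  of the length costs only a constant.\<close>

lemma central_correction:
  fixes m :: nat
  obtains C :: nat where "\<And>L M g j. wl g \<le> L \<Longrightarrow> int L ^ 2 \<le> int m * \<bar>hq g\<bar> \<Longrightarrow> \<bar>j\<bar> \<le> int M * int L \<Longrightarrow>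
    wl (g + pw gz j) \<le> wl g + C * (M + 1)"
proof
  define k where "k = nat K"
  have k: "int k = K" "1 \<le> k" using K_pos by (auto simp: k_def)
  let ?C = "4 * m * k * (2 * wl gx + 2 * wl gy + k * wl gz)"
  fix L M g and j :: int
  assume L: "wl g \<le> L" and q: "int L ^ 2 \<le> int m * \<bar>hq g\<bar>" and j: "\<bar>j\<bar> \<le> int M * int L"
  have "wl (g + pw gz j) \<le> wl g + ?C * M"
  proof (cases "L \<le> 2 * m * k")
    case True
    have "nat \<bar>j\<bar> \<le> M * L" using j by (simp add: nat_le_iff)
    also have "\<dots> \<le> M * (2 * m * k)" using True by simp
    finally have "nat \<bar>j\<bar> * wl gz \<le> M * (2 * m * k) * wl gz" by simp
    moreover have "M * (2 * m * k) * wl gz \<le> ?C * M"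
    proof -
      have "M * m * k * wl gz * 1 \<le> M * m * k * wl gz * k" using k by (intro mult_le_mono2) simp
      moreover have "?C * M = 4 * (M * m * k * (2 * wl gx + 2 * wl gy)) + 4 * (M * m * k * wl gz * k)"
        by (simp add: algebra_simps)
      moreover have "M * (2 * m * k) * wl gz = 2 * (M * m * k * wl gz * 1)" by simp
      ultimately show ?thesis by linarith
    qed
    ultimately show ?thesis using wl_add[of g "pw gz j"] wl_pw[of gz j] by linarith
  next
    case False
    obtain w where w: "set w \<subseteq> S" "length w = wl g" "sum_list w = g" by (metis geodesic_word)
    \<comment> \<open>A large area forces some prefix to go far away from the origin.\<close>
    have "\<exists>i\<le>length w. L \<le> 2 * m * k * n1 (sum_list (take i w))"
    proof (rule ccontr)
      assume *: "\<not> ?thesis"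
      define Q where "Q = L div (2 * m * k)"
      have "0 < m" using q False by (cases m) auto
      have "n1 (sum_list (take i w)) \<le> int Q" if "i \<le> length w" for i
      proof -
        have "int (2 * m * k) * n1 (sum_list (take i w)) < int L" using * that by (meson not_le)
        then have "nat (n1 (sum_list (take i w))) * (2 * m * k) \<le> L"
          by (smt (verit, best) int_nat_eq mult.commute n1_nonneg nat_int_comparison(3) of_nat_mult)
        then have "nat (n1 (sum_list (take i w))) \<le> Q"
          unfolding Q_def using \<open>0 < m\<close> k(2) by (subst less_eq_div_iff_mult_less_eq) auto
        then show ?thesis by linarith
      qed
      then have "\<bar>hq g\<bar> \<le> int (length w) * (K * (1 + int Q))"
        using hq_word_prefixes[OF w(1), of "int Q"] w(3) by simp
      also have "\<dots> \<le> int L * (K * (1 + int Q))" using w(2) L K_pos by (intro mult_right_mono) auto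
      finally have "2 * int m * \<bar>hq g\<bar> \<le> 2 * int m * (int L * (K * (1 + int Q)))"
        by (intro mult_left_mono) auto
      then have "2 * int L ^ 2 \<le> int L * (int (2 * m * k) + int (2 * m * k) * int Q)"
        using q k by (simp add: algebra_simps)
      also have "int (2 * m * k) * int Q \<le> int L"
        unfolding Q_def of_nat_mult[symmetric] by (simp add: mult.commute del: of_nat_mult)
      finally have "2 * int L ^ 2 \<le> int L * (int (2 * m * k) + int L)" by (simp add: mult_left_mono)
      moreover have "int L * (int (2 * m * k) + int L) < int L * (int L + int L)"
        using False by (intro mult_strict_left_mono add_strict_right_mono)
          (auto simp only: not_le of_nat_less_iff of_nat_0_less_iff)
      ultimately show False by (simp add: power2_eq_square)
    qed
    then obtain i where i: "i \<le> length w" "L \<le> 2 * m * k * n1 (sum_list (take i w))" by blast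
    define P where "P t = sum_list (take t w)" for t
    have "\<exists>e\<in>{gx, gy}. int L \<le> int (4 * m * k) * \<bar>det e (P i)\<bar>"
    proof -
      have "n1 (P i) \<le> 2 * \<bar>det gx (P i)\<bar> \<or> n1 (P i) \<le> 2 * \<bar>det gy (P i)\<bar>"
        by (simp add: n1_def det_def) linarith
      then obtain e where "e \<in> {gx, gy}" "n1 (P i) \<le> 2 * \<bar>det e (P i)\<bar>" by blast
      moreover have "int L \<le> int (4 * m * k) * \<bar>det e (P i)\<bar>"
      proof -
        have "int L \<le> int (2 * m * k) * n1 (P i)" using i(2) unfolding P_def by simp
        also have "\<dots> \<le> int (2 * m * k) * (2 * \<bar>det e (P i)\<bar>)"
          using \<open>n1 (P i) \<le> 2 * \<bar>det e (P i)\<bar>\<close> by (intro mult_left_mono) auto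
        finally show ?thesis by simp
      qed
      ultimately show ?thesis by blast
    qed
    then obtain e where e: "e \<in> {gx, gy}" "int L \<le> int (4 * m * k) * \<bar>det e (P i)\<bar>" by blast
    define n where "n = 4 * m * k * M"
    define \<sigma> :: int where "\<sigma> = (if (0 \<le> j) = (0 \<le> det e (P i)) then 1 else -1)"
    define f where "f t = int n * \<sigma> * det e (P t)" for t
    have big: "\<bar>j\<bar> \<le> int n * \<bar>det e (P i)\<bar>"
    proof -
      have "\<bar>j\<bar> \<le> int M * (int (4 * m * k) * \<bar>det e (P i)\<bar>)"
        using j e(2) mult_left_mono[of "int L" _ "int M"] by fastforce
      then show ?thesis by (simp add: n_def algebra_simps)
    qed
    have step: "\<bar>f (Suc t) - f t\<bar> \<le> int n * K" if "t < i" for t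
    proof -
      have t: "t < length w" using that i by simp
      have "P (Suc t) = P t + w ! t" using t by (simp add: P_def take_Suc_conv_app_nth)
      then have "f (Suc t) - f t = int n * \<sigma> * det e (w ! t)" by (simp add: f_def det_add algebra_simps)
      moreover have "\<bar>\<sigma>\<bar> = 1" by (simp add: \<sigma>_def)
      moreover have "\<bar>det e (w ! t)\<bar> \<le> K"
        using det_le[of e "w ! t"] e(1) letter_bounds(1)[of "w ! t"] w(1) t
        by (auto simp: n1_def in_set_conv_nth subset_iff)
      ultimately show ?thesis by (simp add: abs_mult mult_left_mono)
    qed
    have "f 0 = 0" by (simp add: f_def P_def)
    have nK: "0 \<le> int n * K" using K_pos by simp
    have "\<exists>t\<le>i. \<bar>f t - j\<bar> \<le> int n * K"
    proof (cases "0 \<le> j")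
      case True
      have "f i = int n * \<bar>det e (P i)\<bar>" using True by (simp add: f_def \<sigma>_def)
      then have "j \<le> f i" using big True by linarith
      moreover have "f (Suc t) \<le> f t + int n * K" if "t < i" for t
        using step[OF that] by linarith
      ultimately obtain t where "t \<le> i" "f t \<le> j" "j \<le> f t + int n * K"
        using discrete_intermediate_value[of f j i "int n * K"] True nK \<open>f 0 = 0\<close> by auto
      then show ?thesis by (intro exI[of _ t]) auto
    next
      case False
      have "f i = - (int n * \<bar>det e (P i)\<bar>)" using False by (simp add: f_def \<sigma>_def)
      then have "- j \<le> - f i" using big False by linarith
      moreover have "- f (Suc t) \<le> - f t + int n * K" if "t < i" for t
        using step[OF that] by linarith
      ultimately obtain t where "t \<le> i" "- f t \<le> - j" "- j \<le> - f t + int n * K"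
        using discrete_intermediate_value[of "\<lambda>t. - f t" "- j" i "int n * K"] False nK \<open>f 0 = 0\<close> by auto
      then show ?thesis by (intro exI[of _ t]) auto
    qed
    then obtain t where t: "t \<le> i" "\<bar>f t - j\<bar> \<le> int n * K" by blast
    define h where "h = pw e (int n * \<sigma>)"
    define R where "R = sum_list (drop t w)"
    have g: "g = P t + R" using w(3) by (simp add: P_def R_def flip: sum_list_append)
    have "h + P t + - h + R = g + pw gz (f t)"
      by (rule heis_eqI) (simp_all add: g h_def f_def hq_add hq_diff det_add det_def algebra_simps)
    then have eq: "g + pw gz j = h + P t + - h + R + pw gz (j - f t)"
      by (simp add: add.assoc pw_add[symmetric])
    have "wl (P t) \<le> t"
      using wl_le[of "take t w"] w(1) set_take_subset[of t w] unfolding P_def by simp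
    moreover have "wl R \<le> wl g - t"
      using wl_le[of "drop t w"] w(1,2) set_drop_subset[of t w] unfolding R_def by simp
    moreover have "wl h \<le> n * (wl gx + wl gy)"
    proof -
      have "\<bar>int n * \<sigma>\<bar> = int n" by (simp add: \<sigma>_def)
      then have "wl h \<le> n * wl e" using wl_pw[of e "int n * \<sigma>"] by (simp add: h_def)
      also have "\<dots> \<le> n * (wl gx + wl gy)" using e(1) by auto
      finally show ?thesis .
    qed
    moreover have "wl (pw gz (j - f t)) \<le> n * k * wl gz"
    proof -
      have "nat \<bar>j - f t\<bar> \<le> n * k" using t(2) k(1) by (simp add: nat_le_iff abs_minus_commute)
      then have "nat \<bar>j - f t\<bar> * wl gz \<le> n * k * wl gz" by simp
      then show ?thesis using wl_pw[of gz "j - f t"] by linarith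
    qed
    moreover have "wl (g + pw gz j) \<le> wl h + wl (P t) + wl h + wl R + wl (pw gz (j - f t))"
      unfolding eq
      using wl_add[of "h + P t + - h + R" "pw gz (j - f t)"] wl_add[of "h + P t + - h" R]
        wl_add[of "h + P t" "- h"] wl_add[of h "P t"] by simp
    moreover have "t \<le> wl g" using t(1) i(1) w(2) by simp
    ultimately have "wl (g + pw gz j) \<le> wl g + (2 * (n * (wl gx + wl gy)) + n * k * wl gz)" by linarith
    then show ?thesis by (simp add: n_def algebra_simps)
  qed
  then show "wl (g + pw gz j) \<le> wl g + ?C * (M + 1)" by (simp add: algebra_simps)
qed

end


section \<open>Displacement shortens elements of a given area\<close>

text \<open>For a direction \<open>d\<close>, the number \<open>dot d v\<close> measures progress along \<open>d\<close> and \<open>det d v\<close> the level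
  of \<open>v\<close> across \<open>d\<close>.\<close>

definition dot :: "heis \<Rightarrow> heis \<Rightarrow> int" where "dot g h = hx g * hx h + hy g * hy h"

lemma dot_add: "dot d (a + b) = dot d a + dot d b"
  by (simp add: dot_def algebra_simps)

lemma dot_le: "\<bar>dot g h\<bar> \<le> n1 g * n1 h"
proof -
  have "\<bar>dot g h\<bar> \<le> \<bar>hx g\<bar> * \<bar>hx h\<bar> + \<bar>hy g\<bar> * \<bar>hy h\<bar>"
    unfolding dot_def by (metis abs_mult abs_triangle_ineq)
  also have "\<dots> \<le> n1 g * n1 h"
    unfolding n1_def by (simp add: algebra_simps)
  finally show ?thesis .
qed

lemma n1_square_le: "n1 d * n1 d \<le> 2 * dot d d"
proof -
  have "0 \<le> (\<bar>hx d\<bar> - \<bar>hy d\<bar>) * (\<bar>hx d\<bar> - \<bar>hy d\<bar>)" by simp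
  then show ?thesis unfolding n1_def dot_def by (simp add: algebra_simps)
qed

lemma dot_self_pos: "n1 d \<noteq> 0 \<Longrightarrow> 0 < dot d d"
  unfolding n1_def dot_def by (metis abs_zero add.right_neutral not_sum_squares_lt_zero
      linorder_neqE_linordered_idom sum_squares_eq_zero_iff)

text \<open>If \<open>v - w\<close> has components \<open>a\<close> along \<open>d\<close> and \<open>b\<close> across \<open>d\<close>, both scaled by the length of \<open>d\<close>, then
  \<open>|d|\<^sup>2 (v - w) = a d + b d\<^sup>\<bottom>\<close>.\<close>

lemma n1_from_components:
  assumes "dot d v - dot d w = a" "det d v - det d w = b" "n1 d \<noteq> 0"
  shows "dot d d * (\<bar>hx v - hx w\<bar> + \<bar>hy v - hy w\<bar>) \<le> (\<bar>a\<bar> + \<bar>b\<bar>) * n1 d"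
proof -
  have "dot d d * (hx v - hx w) = a * hx d - b * hy d" "dot d d * (hy v - hy w) = a * hy d + b * hx d"
    unfolding assms(1,2)[symmetric] dot_def det_def by (simp_all add: algebra_simps)
  moreover have "0 < dot d d" by (rule dot_self_pos[OF assms(3)])
  ultimately have "dot d d * \<bar>hx v - hx w\<bar> = \<bar>a * hx d - b * hy d\<bar>"
      "dot d d * \<bar>hy v - hy w\<bar> = \<bar>a * hy d + b * hx d\<bar>"
    by (metis abs_mult abs_of_pos)+
  moreover have "\<bar>a * hx d - b * hy d\<bar> \<le> \<bar>a\<bar> * \<bar>hx d\<bar> + \<bar>b\<bar> * \<bar>hy d\<bar>"
    by (metis abs_mult abs_triangle_ineq4)
  moreover have "\<bar>a * hy d + b * hx d\<bar> \<le> \<bar>a\<bar> * \<bar>hy d\<bar> + \<bar>b\<bar> * \<bar>hx d\<bar>"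
    by (metis abs_mult abs_triangle_ineq)
  ultimately show ?thesis by (simp add: n1_def algebra_simps)
qed

lemma dot_det_identity: "dot d d * det a m = dot d a * det d m - det d a * dot d m"
  unfolding dot_def det_def by (simp add: algebra_simps)

text \<open>Start at a point of maximal level. The prefixes that run past the old end point do not rise above
  this level because the total level is not positive.\<close>

lemma rotate_to_maximal_level:
  fixes M :: "heis list"
  assumes "det d (sum_list M) \<le> 0"
  obtains A B where "M = A @ B" "0 \<le> det d (sum_list A)"
    "\<And>i. det d (sum_list (take i (B @ A))) \<le> 0"
proof -
  let ?lev = "\<lambda>i. det d (sum_list (take i M))"
  have "finite (?lev ` {..length M})" "?lev ` {..length M} \<noteq> {}" by auto
  from Max_in[OF this] obtain i where i: "i \<in> {..length M}" "Max (?lev ` {..length M}) = ?lev i"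
    by (elim imageE)
  have max: "?lev j \<le> ?lev i" for j
  proof (cases "j \<le> length M")
    case True
    then show ?thesis using Max_ge[of "?lev ` {..length M}" "?lev j"] i by auto
  next
    case False
    then have "?lev j = ?lev (length M)" by simp
    moreover have "?lev (length M) \<in> ?lev ` {..length M}" by (rule imageI) simp
    ultimately show ?thesis using Max_ge[of "?lev ` {..length M}" "?lev (length M)"] i(2) by simp
  qed
  let ?A = "take i M" and ?B = "drop i M"
  have AB: "det d (sum_list M) = det d (sum_list ?A) + det d (sum_list ?B)"
    using append_take_drop_id[of i M] by (metis det_add(2) sum_list_append)
  show thesis
  proof (rule that[of ?A ?B])
    show "M = ?A @ ?B" by simp
    show "0 \<le> det d (sum_list ?A)" using max[of 0] by simp
    fix j
    show "det d (sum_list (take j (?B @ ?A))) \<le> 0"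
    proof (cases "j \<le> length ?B")
      case True
      have "take (i + j) M = ?A @ take j ?B" by (rule take_add)
      then have "?lev (i + j) = ?lev i + det d (sum_list (take j ?B))" by (simp add: det_add)
      then show ?thesis using max[of "i + j"] True by simp
    next
      case False
      then have "take j (?B @ ?A) = ?B @ take (min (j - length ?B) i) M" by (simp add: min.commute)
      then show ?thesis using max[of "min (j - length ?B) i"] AB assms by (simp add: det_add)
    qed
  qed
qed

context heis_generators
begin

text \<open>A path that starts at its highest level with respect to \<open>d\<close> and ends only slightly below it.\<close>

definition lowered :: "heis \<Rightarrow> heis list \<Rightarrow> bool" where
  "lowered d V \<longleftrightarrow> set V \<subseteq> S \<and> (\<forall>i. det d (sum_list (take i V)) \<le> 0) \<and>
     - (K * n1 d) \<le> det d (sum_list V)"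

lemma lowered_total: "lowered d V \<Longrightarrow> det d (sum_list V) \<le> 0"
  unfolding lowered_def by (metis order_refl take_all)

lemma level_step: "set V \<subseteq> S \<Longrightarrow> \<bar>det d (sum_list (take (Suc t) V)) - det d (sum_list (take t V))\<bar> \<le> K * n1 d"
proof (cases "t < length V")
  case True
  assume "set V \<subseteq> S"
  then have "n1 (V ! t) \<le> K" using letter_bounds(1) True by (meson nth_mem subsetD)
  then have "\<bar>det d (V ! t)\<bar> \<le> K * n1 d"
    using det_le[of d "V ! t"] mult_left_mono[of "n1 (V ! t)" K "n1 d"] by (simp add: mult.commute)
  then show ?thesis using True by (simp add: take_Suc_conv_app_nth det_add)
qed (use K_pos in simp)

text \<open>Walk from both ends of the path until \<open>R\<close> steps have been made on one side. The depths that are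
  reached grow by at most \<open>K * n1 d\<close> per step, so on the side that has descended further one finds a point whose
  depth agrees with the depth on the other side up to one step. The rounding is chosen
  such that the remaining path does not end above its starting point.\<close>

lemma cut_near_top:
  assumes V: "lowered d V" and R: "2 * R \<le> length V"
  obtains P M Q where "V = P @ M @ Q" "length P \<le> R" "length Q \<le> R" "R \<le> length P + length Q"
    "- (K * n1 d) \<le> det d (sum_list M)" "det d (sum_list M) \<le> 0"
proof -
  let ?n = "length V" and ?D = "K * n1 d"
  define f where "f y = - det d (sum_list (take y V))" for y
  have V': "set V \<subseteq> S" "\<And>y. 0 \<le> f y" "f ?n \<le> ?D" "f 0 = 0"
    using V by (auto simp: lowered_def f_def)
  have D: "0 \<le> ?D" using K_pos by simp
  have step: "\<bar>f (Suc t) - f t\<bar> \<le> ?D" for t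
    using level_step[OF V'(1), of d t] by (simp add: f_def)
  have "\<exists>y x. y \<le> R \<and> x \<le> R \<and> R \<le> y + x \<and> f y \<le> f (?n - x) \<and> f (?n - x) \<le> f y + ?D"
  proof (cases "f (?n - R) \<le> f R")
    case True
    have "f (Suc t) \<le> f t + ?D" for t using step[of t] by linarith
    then obtain y where "y \<le> R" "f y \<le> f (?n - R)" "f (?n - R) \<le> f y + ?D"
      using discrete_intermediate_value[of f "f (?n - R)" R ?D] True V' D by auto
    then show ?thesis by (intro exI[of _ y] exI[of _ R]) auto
  next
    case False
    show ?thesis
    proof (cases "f R \<le> f ?n")
      case True
      then show ?thesis using V'(2)[of R] V'(3) by (intro exI[of _ R] exI[of _ 0]) auto
    next
      case 2: False
      let ?g = "\<lambda>t. - f (?n - R + t)"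
      have "?g (Suc t) \<le> ?g t + ?D" for t using step[of "?n - R + t"] by simp
      moreover have "?g R = - f ?n" using R by simp
      ultimately obtain t where t: "t \<le> R" "?g t \<le> - f R" "- f R \<le> ?g t + ?D"
        using discrete_intermediate_value[of ?g "- f R" R ?D] False 2 D by auto
      have "?n - (R - t) = ?n - R + t" using t(1) R by simp
      then show ?thesis using t by (intro exI[of _ R] exI[of _ "R - t"]) auto
    qed
  qed
  then obtain y x where xy: "y \<le> R" "x \<le> R" "R \<le> y + x" "f y \<le> f (?n - x)" "f (?n - x) \<le> f y + ?D"
    by blast
  define P M Q where "P = take y V" and "M = take (?n - x - y) (drop y V)" and "Q = drop (?n - x) V"
  have "y + (?n - x - y) = ?n - x" using xy R by simp
  then have PM: "take (?n - x) V = P @ M"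
    unfolding P_def M_def by (metis take_add)
  then have "V = P @ M @ Q" unfolding Q_def by (metis append.assoc append_take_drop_id)
  moreover have "det d (sum_list M) = f y - f (?n - x)"
    using PM unfolding f_def by (simp add: det_add P_def)
  moreover have "length P = y" "length Q = x" using xy R by (auto simp: P_def Q_def)
  ultimately show thesis using that xy by auto
qed

text \<open>The part of the change of area in one shortening step that is bounded independently of the length
  of the word; \<open>R\<close> bounds the lengths of the two pieces that are cut off, and \<open>b\<close> the displacement of the rest.\<close>

definition step_error :: "int \<Rightarrow> int \<Rightarrow> int" where
  "step_error R b = 2 * (R * (K * (1 + K * R))) + K * R * b + (K * R + b) * (K * R) + 4 * (K * R * b)"

text \<open>One step of the construction: cut off two pieces at the top of the loop and rotate the rest so
  that it starts at its top again. The pieces are short, so cutting them off changes the area by a bounded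
  amount. Rotating \<open>a + c\<close> to \<open>c + a\<close> changes it by \<open>2 * det a (a + c)\<close> up to sign; here \<open>a + c\<close> is almost
  parallel to \<open>d\<close>, and the level of \<open>a\<close> is bounded as the new top is close to the old one, which leaves
  an error that is at most linear in the length.\<close>

lemma shorten:
  assumes V: "lowered d V" and R: "2 * R \<le> length V" and d: "n1 d \<noteq> 0" and b: "n1 (sum_list V) \<le> b"
  obtains V' where "lowered d V'" "length V' + R \<le> length V" "length V \<le> length V' + 2 * R"
    "\<bar>dot d (sum_list V') - dot d (sum_list V)\<bar> \<le> 2 * int R * K * n1 d"
    "\<bar>hq (sum_list V') - hq (sum_list V)\<bar> \<le> 4 * K ^ 2 * int (length V) + step_error (int R) (b + 2 * int R * K)"
proof -
  obtain P M Q where split: "V = P @ M @ Q" "length P \<le> R" "length Q \<le> R" "R \<le> length P + length Q"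
    and M: "- (K * n1 d) \<le> det d (sum_list M)" "det d (sum_list M) \<le> 0"
    by (rule cut_near_top[OF V R])
  obtain A B where AB: "M = A @ B" "0 \<le> det d (sum_list A)" "\<And>i. det d (sum_list (take i (B @ A))) \<le> 0"
    by (rule rotate_to_maximal_level[OF M(2)]) blast
  define p m q a c where defs: "p = sum_list P" "m = sum_list M" "q = sum_list Q" "a = sum_list A" "c = sum_list B"
  have S: "set P \<subseteq> S" "set M \<subseteq> S" "set Q \<subseteq> S" "set A \<subseteq> S" "set B \<subseteq> S"
    using V split AB by (auto simp: lowered_def)
  have v: "sum_list V = p + m + q" by (simp add: split defs add.assoc)
  have m: "m = a + c" by (simp add: AB defs)
  let ?R = "int R"
  define b' where "b' = b + 2 * ?R * K"
  have KR: "0 \<le> K * ?R" using K_pos by simp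
  have short: "n1 (sum_list w) \<le> K * ?R" "\<bar>hq (sum_list w)\<bar> \<le> ?R * (K * (1 + K * ?R))"
    if "set w \<subseteq> S" "length w \<le> R" for w
  proof -
    have "n1 (sum_list w) \<le> K * int (length w)" by (rule n1_word[OF that(1)])
    also have "\<dots> \<le> K * ?R" using K_pos that(2) by (intro mult_left_mono) auto
    finally show "n1 (sum_list w) \<le> K * ?R" .
    have "\<bar>hq (sum_list w)\<bar> \<le> int (length w) * (K * (1 + K * int (length w)))" by (rule hq_word[OF that(1)])
    also have "\<dots> \<le> ?R * (K * (1 + K * ?R))"
      using K_pos that(2) by (intro mult_mono add_left_mono mult_left_mono) auto
    finally show "\<bar>hq (sum_list w)\<bar> \<le> ?R * (K * (1 + K * ?R))" .
  qed
  have p: "n1 p \<le> K * ?R" "\<bar>hq p\<bar> \<le> ?R * (K * (1 + K * ?R))"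
    and q: "n1 q \<le> K * ?R" "\<bar>hq q\<bar> \<le> ?R * (K * (1 + K * ?R))"
    using short S split by (auto simp: defs)
  have mb: "n1 m \<le> b'"
  proof -
    have "n1 m \<le> n1 (sum_list V) + n1 p + n1 q" unfolding v n1_def by simp
    then show ?thesis using b p(1) q(1) unfolding b'_def by (simp add: algebra_simps)
  qed
  have "0 \<le> b'" using mb n1_nonneg[of m] by linarith
  have pos: "0 < dot d d" by (rule dot_self_pos[OF d])
  have det_am: "\<bar>det a m\<bar> \<le> 2 * (K ^ 2 * int (length V) + K * ?R * b')"
  proof -
    have "n1 a \<le> K * int (length V)"
    proof -
      have "n1 a \<le> K * int (length A)" unfolding defs by (rule n1_word[OF S(4)])
      also have "\<dots> \<le> K * int (length V)" using K_pos by (intro mult_left_mono) (auto simp: split AB)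
      finally show ?thesis .
    qed
    then have "\<bar>dot d a\<bar> \<le> n1 d * (K * int (length V))"
      using dot_le[of d a] mult_left_mono[of "n1 a" _ "n1 d"] by fastforce
    moreover have "\<bar>det d m\<bar> \<le> K * n1 d" using M by (simp add: defs)
    ultimately have 1: "\<bar>dot d a * det d m\<bar> \<le> (n1 d * (K * int (length V))) * (K * n1 d)"
      unfolding abs_mult by (intro mult_mono) auto
    \<comment> \<open>The top of \<open>M\<close> is not above the top of \<open>V\<close>, which is its starting point.\<close>
    have "take (length P + length A) V = P @ A" by (simp add: split AB)
    then have "det d p + det d a \<le> 0"
      using V unfolding lowered_def defs by (metis det_add(2) sum_list_append)
    moreover have "\<bar>det d p\<bar> \<le> n1 d * (K * ?R)"
      using det_le[of d p] p(1) mult_left_mono[of "n1 p" _ "n1 d"] by fastforce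
    ultimately have "\<bar>det d a\<bar> \<le> n1 d * (K * ?R)" using AB(2) unfolding defs by linarith
    moreover have "\<bar>dot d m\<bar> \<le> n1 d * b'"
      using dot_le[of d m] mb mult_left_mono[of "n1 m" _ "n1 d"] by fastforce
    ultimately have 2: "\<bar>det d a * dot d m\<bar> \<le> (n1 d * (K * ?R)) * (n1 d * b')"
      unfolding abs_mult using KR by (intro mult_mono) auto
    have "dot d d * \<bar>det a m\<bar> = \<bar>dot d a * det d m - det d a * dot d m\<bar>"
      using dot_det_identity[of d a m] pos by (metis abs_mult abs_of_pos)
    also have "\<dots> \<le> (n1 d * n1 d) * (K ^ 2 * int (length V) + K * ?R * b')"
      using 1 2 by (simp add: power2_eq_square algebra_simps)
    also have "\<dots> \<le> (2 * dot d d) * (K ^ 2 * int (length V) + K * ?R * b')"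
      using n1_square_le[of d] KR \<open>0 \<le> b'\<close> by (intro mult_right_mono) auto
    also have "\<dots> = dot d d * (2 * (K ^ 2 * int (length V) + K * ?R * b'))" by (simp add: algebra_simps)
    finally show ?thesis using pos mult_le_cancel_left_pos by blast
  qed
  show thesis
  proof (rule that[of "B @ A"])
    have same: "det d (sum_list (B @ A)) = det d m" "dot d (sum_list (B @ A)) = dot d m"
      by (simp_all add: m defs det_add dot_add)
    then show "lowered d (B @ A)" using S AB(3) M by (auto simp: lowered_def defs)
    show "length (B @ A) + R \<le> length V" "length V \<le> length (B @ A) + 2 * R"
      using split AB by auto
    have "\<bar>dot d p\<bar> \<le> n1 d * (K * ?R)" "\<bar>dot d q\<bar> \<le> n1 d * (K * ?R)"
      using dot_le[of d p] dot_le[of d q] p(1) q(1) mult_left_mono[of _ "K * ?R" "n1 d"]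
      by (meson n1_nonneg order_trans)+
    then have "\<bar>dot d p\<bar> + \<bar>dot d q\<bar> \<le> 2 * ?R * K * n1 d" by (simp add: algebra_simps)
    moreover have "dot d (sum_list V) = dot d p + dot d m + dot d q" by (simp add: v dot_add)
    ultimately show "\<bar>dot d (sum_list (B @ A)) - dot d (sum_list V)\<bar> \<le> 2 * ?R * K * n1 d"
      unfolding same by linarith
    have "\<bar>det p m\<bar> \<le> (K * ?R) * b'"
      using det_le[of p m] mult_mono[OF p(1) mb KR] by simp
    moreover have "\<bar>det (p + m) q\<bar> \<le> (K * ?R + b') * (K * ?R)"
    proof -
      have "n1 (p + m) \<le> K * ?R + b'" using n1_add[of p m] p(1) mb by linarith
      then show ?thesis
        using det_le[of "p + m" q] mult_mono[OF _ q(1), of "n1 (p + m)" "K * ?R + b'"] KR \<open>0 \<le> b'\<close> by simp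
    qed
    moreover have "hq (sum_list (B @ A)) = hq m - 2 * det a m"
      by (simp add: m defs[symmetric] hq_add_det det_add det_swap[of a c])
    moreover have "hq (sum_list V) = hq p + hq m + hq q + det p m + det (p + m) q"
      by (simp add: v hq_add_det)
    ultimately show "\<bar>hq (sum_list (B @ A)) - hq (sum_list V)\<bar>
        \<le> 4 * K ^ 2 * int (length V) + step_error ?R (b + 2 * ?R * K)"
      using p(2) q(2) det_am unfolding step_error_def b'_def[symmetric] by (simp add: algebra_simps)
  qed
qed

lemma inside_bound:
  assumes V: "lowered d V" "\<bar>dot d (sum_list V)\<bar> < dot d d" and d: "n1 d \<noteq> 0"
  shows "n1 (sum_list V) \<le> n1 d + 2 * K"
proof -
  have "dot d d * n1 (sum_list V) \<le> (\<bar>dot d (sum_list V)\<bar> + \<bar>det d (sum_list V)\<bar>) * n1 d"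
    using n1_from_components[of d "sum_list V" 0, OF HOL.refl HOL.refl d] by (simp add: n1_def dot_def det_def)
  also have "\<dots> \<le> (dot d d + K * n1 d) * n1 d"
    using V lowered_total[OF V(1)] by (intro mult_right_mono add_mono) (auto simp: lowered_def)
  also have "\<dots> \<le> dot d d * n1 d + K * (2 * dot d d)"
    using mult_left_mono[OF n1_square_le[of d], of K] K_pos by (simp add: algebra_simps)
  finally have "dot d d * n1 (sum_list V) \<le> dot d d * (n1 d + 2 * K)" by (simp add: algebra_simps)
  then show ?thesis using dot_self_pos[OF d] by simp
qed

text \<open>Iterating the shortening step, one stops as soon as the progress along \<open>d\<close> reaches the length of \<open>d\<close>
  in one of the two directions. The first alternative says that this has not happened during the first \<open>i\<close>
  steps.\<close>

lemma walk:
  assumes W: "lowered d W" "dot d (sum_list W) = 0" and d: "n1 d \<noteq> 0"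
    and long: "2 * R * (i + 1) \<le> length W"
      "step_error (int R) (n1 d + 2 * K + 2 * int R * K) \<le> int (length W)"
  shows "(\<exists>V. lowered d V \<and> length V + i * R \<le> length W \<and> length W \<le> length V + 2 * R * i \<and>
      \<bar>hq (sum_list V) - hq (sum_list W)\<bar> \<le> int i * (4 * K ^ 2 + 1) * int (length W) \<and>
      \<bar>dot d (sum_list V)\<bar> \<le> int i * (2 * int R * K * n1 d) \<and> \<bar>dot d (sum_list V)\<bar> < dot d d) \<or>
    (\<exists>i0 V. i0 \<le> i \<and> lowered d V \<and> length V + i0 * R \<le> length W \<and>
      \<bar>hq (sum_list V) - hq (sum_list W)\<bar> \<le> int i0 * (4 * K ^ 2 + 1) * int (length W) \<and>
      \<bar>dot d (sum_list V)\<bar> \<le> int i0 * (2 * int R * K * n1 d) \<and>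
      dot d d \<le> \<bar>dot d (sum_list V)\<bar> \<and> \<bar>dot d (sum_list V)\<bar> \<le> dot d d + 2 * int R * K * n1 d)"
  using long(1)
proof (induction i)
  case 0
  then show ?case using W dot_self_pos[OF d] by (intro disjI1 exI[of _ W]) auto
next
  case (Suc i)
  then have "2 * R * (i + 1) \<le> length W" by simp
  with Suc.IH consider
    (inside) V where "lowered d V" "length V + i * R \<le> length W" "length W \<le> length V + 2 * R * i"
      "\<bar>hq (sum_list V) - hq (sum_list W)\<bar> \<le> int i * (4 * K ^ 2 + 1) * int (length W)"
      "\<bar>dot d (sum_list V)\<bar> \<le> int i * (2 * int R * K * n1 d)" "\<bar>dot d (sum_list V)\<bar> < dot d d"
    | (outside) i0 V where "i0 \<le> i" "lowered d V" "length V + i0 * R \<le> length W"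
      "\<bar>hq (sum_list V) - hq (sum_list W)\<bar> \<le> int i0 * (4 * K ^ 2 + 1) * int (length W)"
      "\<bar>dot d (sum_list V)\<bar> \<le> int i0 * (2 * int R * K * n1 d)"
      "dot d d \<le> \<bar>dot d (sum_list V)\<bar>" "\<bar>dot d (sum_list V)\<bar> \<le> dot d d + 2 * int R * K * n1 d"
    by blast
  then show ?case
  proof cases
    case outside
    then show ?thesis using le_SucI by blast
  next
    case inside
    have pos: "0 < dot d d" by (rule dot_self_pos[OF d])
    have "n1 (sum_list V) \<le> n1 d + 2 * K" using inside_bound[OF inside(1,6) d] .
    moreover have "2 * R \<le> length V" using Suc.prems inside(3) by (simp add: algebra_simps)
    ultimately obtain V' where V': "lowered d V'" "length V' + R \<le> length V" "length V \<le> length V' + 2 * R"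
        "\<bar>dot d (sum_list V') - dot d (sum_list V)\<bar> \<le> 2 * int R * K * n1 d"
        "\<bar>hq (sum_list V') - hq (sum_list V)\<bar>
          \<le> 4 * K ^ 2 * int (length V) + step_error (int R) (n1 d + 2 * K + 2 * int R * K)"
      using shorten[OF inside(1) _ d] by metis
    have "4 * K ^ 2 * int (length V) \<le> 4 * K ^ 2 * int (length W)"
      using inside(2) by (intro mult_left_mono) auto
    then have "\<bar>hq (sum_list V') - hq (sum_list V)\<bar> \<le> (4 * K ^ 2 + 1) * int (length W)"
      using V'(5) long(2) by (simp add: algebra_simps)
    then have q: "\<bar>hq (sum_list V') - hq (sum_list W)\<bar> \<le> int (Suc i) * (4 * K ^ 2 + 1) * int (length W)"
      using inside(4) by (simp add: algebra_simps)
    have dot: "\<bar>dot d (sum_list V')\<bar> \<le> int (Suc i) * (2 * int R * K * n1 d)"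
      using inside(5) V'(4) by (simp add: algebra_simps)
    have len: "length V' + Suc i * R \<le> length W" "length W \<le> length V' + 2 * R * Suc i"
      using inside(2,3) V'(2,3) by (auto simp: algebra_simps)
    show ?thesis
    proof (cases "\<bar>dot d (sum_list V')\<bar> < dot d d")
      case True
      then show ?thesis using V'(1) q dot len by blast
    next
      case False
      then have "dot d d \<le> \<bar>dot d (sum_list V')\<bar>" "\<bar>dot d (sum_list V')\<bar> \<le> dot d d + 2 * int R * K * n1 d"
        using inside(6) V'(4) by linarith+
      then show ?thesis using V'(1) q dot len(1) by (intro disjI2 exI[of _ "Suc i"] exI[of _ V']) auto
    qed
  qed
qed

lemma central_difference:
  assumes "hx g = hx h" "hy g = hy h"
  obtains j where "g = h + pw gz j" "2 * j = hq g - hq h"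
proof -
  obtain a b c a' b' c' where *: "g = pw gx a + pw gy b + pw gz c" "h = pw gx a' + pw gy b' + pw gz c'"
    using normal_form by metis
  then have "a = a'" "b = b'" using assms by auto
  then have "hq g - hq h = 2 * (c - c')" using * by (simp add: hq_add)
  then show thesis using assms by (intro that[of "c - c'"] heis_eqI) (auto simp: hq_add)
qed

text \<open>A word \<open>V\<close> gives a short word for every element \<open>g\<close> whose displacement is close and whose area differs
  by the order of the length: multiply by powers of the two generators to obtain the right displacement, and then
  correct the area.\<close>

lemma near_word:
  fixes m C L M :: nat
  assumes corr: "\<And>L M g j. wl g \<le> L \<Longrightarrow> int L ^ 2 \<le> int m * \<bar>hq g\<bar> \<Longrightarrow> \<bar>j\<bar> \<le> int M * int L \<Longrightarrow>
      wl (g + pw gz j) \<le> wl g + C * (M + 1)"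
    and V: "set V \<subseteq> S" "length V \<le> L"
    and \<delta>: "\<bar>hx g - hx (sum_list V)\<bar> + \<bar>hy g - hy (sum_list V)\<bar> \<le> \<delta>" "n1 (sum_list V) \<le> b"
    and c: "c = int (wl gx + wl gy)" "c * \<delta> \<le> int L"
    and area: "\<bar>hq g - hq (sum_list V)\<bar> + \<delta> * \<delta> + b * \<delta> \<le> 4 * int M * int L"
      "4 * int L ^ 2 \<le> int m * (hq (sum_list V) - \<delta> * \<delta> - b * \<delta>)"
  shows "int (wl g) \<le> int (length V) + c * \<delta> + int C * (int M + 1)"
proof -
  let ?v = "sum_list V"
  define e f where ef: "e = hx g - hx ?v" "f = hy g - hy ?v"
  define h where "h = pw gx e + pw gy f"
  have \<delta>': "\<bar>e\<bar> \<le> \<delta>" "\<bar>f\<bar> \<le> \<delta>" "n1 h \<le> \<delta>" "0 \<le> \<delta>" "0 \<le> b"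
    using \<delta> n1_nonneg[of ?v] by (auto simp: ef h_def n1_def)
  have h: "int (wl h) \<le> c * \<delta>"
  proof -
    have "int (wl h) \<le> int (nat \<bar>e\<bar> * wl gx) + int (nat \<bar>f\<bar> * wl gy)"
      using wl_add[of "pw gx e" "pw gy f"] wl_pw[of gx e] wl_pw[of gy f] unfolding h_def by linarith
    also have "\<dots> = \<bar>e\<bar> * int (wl gx) + \<bar>f\<bar> * int (wl gy)" by simp
    also have "\<dots> \<le> \<delta> * int (wl gx) + \<delta> * int (wl gy)"
      using \<delta>' by (intro add_mono mult_right_mono) auto
    finally show ?thesis by (simp add: c algebra_simps)
  qed
  have q: "\<bar>hq (?v + h) - hq ?v\<bar> \<le> \<delta> * \<delta> + b * \<delta>"
  proof -
    have "\<bar>hq h\<bar> = \<bar>e\<bar> * \<bar>f\<bar>" by (simp add: h_def hq_add abs_mult)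
    also have "\<dots> \<le> \<delta> * \<delta>" using \<delta>' by (intro mult_mono) auto
    finally have "\<bar>hq h\<bar> \<le> \<delta> * \<delta>" .
    moreover have "\<bar>det ?v h\<bar> \<le> b * \<delta>"
      using det_le[of ?v h] mult_mono[OF \<delta>(2) \<delta>'(3)] \<delta>' by simp
    ultimately show ?thesis by (simp add: hq_add_det)
  qed
  have "hx g = hx (?v + h)" "hy g = hy (?v + h)" by (simp_all add: h_def ef)
  then obtain j where j: "g = ?v + h + pw gz j" "2 * j = hq g - hq (?v + h)"
    by (rule central_difference)
  have "wl (?v + h) \<le> length V + wl h" using wl_add[of ?v h] wl_le[OF V(1)] by linarith
  moreover have "wl (?v + h) \<le> 2 * L" using calculation V(2) h c(2) by linarith
  moreover have "int (2 * L) ^ 2 \<le> int m * \<bar>hq (?v + h)\<bar>"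
  proof -
    have "hq ?v - \<delta> * \<delta> - b * \<delta> \<le> \<bar>hq (?v + h)\<bar>" using q by linarith
    then have "int m * (hq ?v - \<delta> * \<delta> - b * \<delta>) \<le> int m * \<bar>hq (?v + h)\<bar>" by (intro mult_left_mono) auto
    then show ?thesis using area(2) by (simp add: power2_eq_square)
  qed
  moreover have "\<bar>j\<bar> \<le> int M * int (2 * L)" using j(2) q area(1) by simp
  ultimately have "wl g \<le> length V + wl h + C * (M + 1)"
    using corr[of "?v + h" "2 * L" j M] unfolding j(1)[symmetric] by linarith
  then have "int (wl g) \<le> int (length V + wl h + C * (M + 1))" by (simp only: of_nat_le_iff)
  then show ?thesis using h by (simp add: distrib_left)
qed

lemma hq_flip: "hq (sum_list (map uminus w)) = hq (sum_list w) - 2 * (\<Sum>s\<leftarrow>w. hq s)"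
proof (induction w)
  case (Cons s w)
  have "hx (sum_list (map uminus w)) = - hx (sum_list w)" "hy (sum_list (map uminus w)) = - hy (sum_list w)"
    by (induction w) auto
  then show ?case using Cons by (simp add: hq_add hq_diff algebra_simps del: hq_minus add_uminus_conv_diff)
      (simp add: hq_add)
qed simp

text \<open>Inverting each letter without reversing their order turns the path by a rotation through \<open>\<pi>\<close>, which
  preserves the area of the path; only the areas of the letters themselves change sign.\<close>

lemma flip_word:
  assumes "set V \<subseteq> S"
  obtains V' where "set V' \<subseteq> S" "length V' = length V" "hx (sum_list V') = - hx (sum_list V)"
    "hy (sum_list V') = - hy (sum_list V)"
    "\<bar>hq (sum_list V') - hq (sum_list V)\<bar> \<le> 2 * K * int (length V)"
proof
  show "set (map uminus V) \<subseteq> S" using uminus_words[OF assms] .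
  show "hx (sum_list (map uminus V)) = - hx (sum_list V)" "hy (sum_list (map uminus V)) = - hy (sum_list V)"
    by (induction V) auto
  have "\<bar>\<Sum>s\<leftarrow>V. hq s\<bar> \<le> K * int (length V)"
    using assms
  proof (induction V)
    case (Cons s V)
    then show ?case using letter_bounds(2)[of s] by (simp add: algebra_simps)
  qed simp
  then show "\<bar>hq (sum_list (map uminus V)) - hq (sum_list V)\<bar> \<le> 2 * K * int (length V)"
    unfolding hq_flip by simp
qed simp

lemma step_error_mono: "0 \<le> R \<Longrightarrow> b \<le> b' \<Longrightarrow> step_error R b \<le> step_error R b'"
  unfolding step_error_def using K_pos by (intro add_mono mult_left_mono mult_right_mono) auto

lemma between_squares:
  assumes "1 \<le> n"
  obtains r :: nat where "1 \<le> r" "n \<le> r ^ 2" "r ^ 2 \<le> 4 * n"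
proof -
  define r where "r = (LEAST r. n \<le> r ^ 2)"
  have r: "n \<le> r ^ 2" unfolding r_def by (rule LeastI[of _ n]) (simp add: power2_eq_square)
  then obtain s where s: "r = Suc s" using assms by (cases r) auto
  have "\<not> n \<le> s ^ 2" using not_less_Least[of s "\<lambda>r. n \<le> r ^ 2"] s unfolding r_def by simp
  moreover have "Suc s ^ 2 = s ^ 2 + 2 * s + 1" by (simp add: power2_eq_square)
  moreover have "s \<le> s ^ 2" unfolding power2_eq_square by (rule le_square)
  ultimately have "r ^ 2 \<le> 4 * n" unfolding s by linarith
  then show thesis using r s that[of r] by (metis le_add1 plus_1_eq_Suc)
qed

text \<open>Walk away from a geodesic loop \<open>W\<close> for the central element \<open>pw gz k\<close> of (almost) the same area as \<open>g\<close>.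
  Each step saves \<open>R\<close> letters, and \<open>R\<close> exceeds the cost \<open>C2 * T\<close> of repairing the area that the step
  destroys. If the walk stayed near the centre for too long, repairing the result would give a word for
  \<open>pw gz k\<close> that is shorter than \<open>W\<close>. So it reaches \<open>g\<close> or its mirror image, which is turned into
  \<open>g\<close> by \<open>flip_word\<close>. This takes at least \<open>n1 g / (4 * R * K)\<close> steps, as each step moves by at most
  \<open>2 * R * K\<close>, and each step has a net gain of one letter.\<close>

lemma center_is_farthest:
  obtains c C :: int where "0 < c" "0 \<le> C"
    "\<And>\<rho>. \<exists>A. \<forall>g. n1 g \<le> \<rho> \<longrightarrow> A \<le> hq g \<longrightarrow>
       (\<exists>k. \<bar>2 * k - hq g\<bar> \<le> 1 \<and> n1 g \<le> c * (int (wl (pw gz k)) - int (wl g) + C))"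
proof -
  obtain C0 :: nat where C0: "\<And>g r. \<bar>hq g\<bar> \<le> int r ^ 2 \<Longrightarrow> int (wl g) \<le> int C0 * (n1 g + int r + 1)"
    using wl_upper_bound by blast
  define m where "m = 128 * C0 ^ 2"
  obtain C2 :: nat where corr: "\<And>L M g j. wl g \<le> L \<Longrightarrow> int L ^ 2 \<le> int m * \<bar>hq g\<bar> \<Longrightarrow>
      \<bar>j\<bar> \<le> int M * int L \<Longrightarrow> wl (g + pw gz j) \<le> wl g + C2 * (M + 1)"
    using central_correction[of m] by blast
  define e where "e = int (wl gx + wl gy)"
  define T where "T = 4 * K ^ 2 + 1"
  define R where "R = nat (int C2 * T + 1)"
  have K: "1 \<le> K" by (rule K_pos)
  have T: "0 \<le> T" by (simp add: T_def)
  have R: "int R = int C2 * T + 1" using T by (simp add: R_def)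
  define \<delta>0 where "\<delta>0 = 4 * int R * K + 2 * K"
  define c where "c = 4 * int R * K"
  define C where "C = e * \<delta>0 + int C2 * (K + 2)"
  have "0 \<le> e" "0 \<le> \<delta>0" using K by (auto simp: e_def \<delta>0_def)
  show thesis
  proof (rule that[of c C])
    show "0 < c" using K R T by (simp add: c_def add_nonneg_pos)
    show "0 \<le> C" using K \<open>0 \<le> e\<close> \<open>0 \<le> \<delta>0\<close> by (simp add: C_def)
    fix \<rho> :: int
    define \<beta> where "\<beta> = \<bar>\<rho>\<bar> + 2 * K"
    define I where "I = nat (e * \<beta> + int C2 * (K + 2)) + 1"
    define \<delta>m where "\<delta>m = \<beta> + \<delta>0"
    define b where "b = \<beta> + \<delta>m"
    define E where "E = int I * T + 2 * K + 1"
    define L1 where "L1 = \<bar>step_error (int R) (\<beta> + 2 * int R * K)\<bar> + int (2 * R * (I + 1)) + e * \<delta>m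
      + (\<delta>m * \<delta>m + b * \<delta>m + 1) + 32 * int C0 ^ 2 * E"
    define A where "A = L1 * (K * (1 + K * L1)) + 3"
    have nonneg: "0 \<le> \<beta>" "0 \<le> \<delta>m" "0 \<le> b" "0 \<le> E"
      using K T \<open>0 \<le> \<delta>0\<close> by (auto simp: \<beta>_def \<delta>m_def b_def E_def)
    have parts: "0 \<le> int (2 * R * (I + 1))" "0 \<le> e * \<delta>m" "0 \<le> \<delta>m * \<delta>m + b * \<delta>m + 1" "0 \<le> 32 * int C0 ^ 2 * E"
      using nonneg \<open>0 \<le> e\<close> by auto
    then have "0 \<le> L1" unfolding L1_def by linarith
    show "\<exists>A. \<forall>g. n1 g \<le> \<rho> \<longrightarrow> A \<le> hq g \<longrightarrow>
       (\<exists>k. \<bar>2 * k - hq g\<bar> \<le> 1 \<and> n1 g \<le> c * (int (wl (pw gz k)) - int (wl g) + C))"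
    proof (rule exI[of _ A], intro allI impI)
      fix g assume g: "n1 g \<le> \<rho>" "A \<le> hq g"
      show "\<exists>k. \<bar>2 * k - hq g\<bar> \<le> 1 \<and> n1 g \<le> c * (int (wl (pw gz k)) - int (wl g) + C)"
      proof (cases "n1 g = 0")
        case True
        then have "hx g = hx 0" "hy g = hy 0" unfolding n1_def by auto
        then obtain j where "g = 0 + pw gz j" "2 * j = hq g - hq 0" by (rule central_difference)
        then show ?thesis using True \<open>0 < c\<close> \<open>0 \<le> C\<close> by (intro exI[of _ j]) auto
      next
        case False
        define k where "k = hq g div 2"
        have k: "\<bar>2 * k - hq g\<bar> \<le> 1" unfolding k_def by linarith
        define L where "L = wl (pw gz k)"
        have "0 \<le> L1 * (K * (1 + K * L1))" using K \<open>0 \<le> L1\<close> by simp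
        then have "1 \<le> k" using k g(2) unfolding A_def by linarith
        have L: "L1 \<le> int L"
        proof (rule ccontr)
          assume "\<not> ?thesis"
          then have "int L * (K * (1 + K * int L)) \<le> L1 * (K * (1 + K * L1))"
            using K \<open>0 \<le> L1\<close> by (intro mult_mono add_left_mono mult_left_mono) auto
          then show False using hq_wl[of "pw gz k"] k g(2) unfolding L_def A_def by (simp add: abs_mult)
        qed
        have area: "int L ^ 2 \<le> 16 * int C0 ^ 2 * (2 * k)"
        proof -
          have "1 \<le> nat (2 * k)" using \<open>1 \<le> k\<close> by simp
          then obtain r :: nat where r: "1 \<le> r" "nat (2 * k) \<le> r ^ 2" "r ^ 2 \<le> 4 * nat (2 * k)"
            by (rule between_squares)
          have r': "2 * k \<le> int r ^ 2" "int r ^ 2 \<le> 8 * k"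
            using r(2,3) \<open>1 \<le> k\<close> unfolding of_nat_power[symmetric] by linarith+
          have "int L \<le> int C0 * (int r + 1)"
            using C0[of "pw gz k" r] r' \<open>1 \<le> k\<close> by (simp add: L_def n1_def abs_mult mult.commute)
          also have "\<dots> \<le> int C0 * (2 * int r)" using r by (intro mult_left_mono) auto
          finally have "int L ^ 2 \<le> (int C0 * (2 * int r)) ^ 2" by (intro power_mono) auto
          also have "\<dots> = 4 * int C0 ^ 2 * int r ^ 2" by (simp add: power_mult_distrib)
          also have "\<dots> \<le> 4 * int C0 ^ 2 * (8 * k)" using r' by (intro mult_left_mono) auto
          finally show ?thesis by simp
        qed
        \<comment> \<open>A word that has lost \<open>i * R\<close> letters at a small cost in area yields a short word for
          any element nearby.\<close>
        have fin: "int (wl h) \<le> int L - int i + e * \<delta> + int C2 * (K + 2)"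
          if "set V \<subseteq> S" "i \<le> I" "length V + i * R \<le> L"
            "\<bar>hq (sum_list V) - 2 * k\<bar> \<le> int i * T * int L + 2 * K * int L" "\<bar>hq h - 2 * k\<bar> \<le> 1"
            "0 \<le> \<delta>" "\<delta> \<le> \<delta>m" "\<bar>hx h - hx (sum_list V)\<bar> + \<bar>hy h - hy (sum_list V)\<bar> \<le> \<delta>"
            "n1 (sum_list V) \<le> b" for V i h \<delta>
        proof -
          define M where "M = nat (int i * T + K + 1)"
          have M: "int M = int i * T + K + 1" using T K by (simp add: M_def)
          have small: "\<delta> * \<delta> + b * \<delta> \<le> \<delta>m * \<delta>m + b * \<delta>m"
            using that(6,7) nonneg by (intro add_mono mult_mono) auto
          have L': "\<delta>m * \<delta>m + b * \<delta>m + 1 \<le> int L" "e * \<delta>m \<le> int L" "32 * int C0 ^ 2 * E \<le> int L"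
            using L parts unfolding L1_def by linarith+
          have "int (wl h) \<le> int (length V) + e * \<delta> + int C2 * (int M + 1)"
          proof (rule near_word[OF corr])
            show "set V \<subseteq> S" "length V \<le> L" using that by auto
            show "\<bar>hx h - hx (sum_list V)\<bar> + \<bar>hy h - hy (sum_list V)\<bar> \<le> \<delta>" "n1 (sum_list V) \<le> b" by fact+
            show "e = int (wl gx + wl gy)" by (rule e_def)
            show "e * \<delta> \<le> int L" using mult_left_mono[OF that(7) \<open>0 \<le> e\<close>] L' by linarith
            have "\<bar>hq h - hq (sum_list V)\<bar> + \<delta> * \<delta> + b * \<delta> \<le> int i * T * int L + 2 * K * int L + int L"
              using that(4,5) small L' by linarith
            also have "\<dots> \<le> 4 * (int i * T * int L) + 4 * (K * int L) + 4 * int L" using T K by simp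
            also have "\<dots> = 4 * int M * int L" by (simp add: M algebra_simps)
            finally show "\<bar>hq h - hq (sum_list V)\<bar> + \<delta> * \<delta> + b * \<delta> \<le> 4 * int M * int L" .
            have "int i * T * int L \<le> int I * T * int L" using that(2) T by (intro mult_right_mono) auto
            then have "2 * k - E * int L \<le> hq (sum_list V) - \<delta> * \<delta> - b * \<delta>"
              using that(4) small L' unfolding E_def by (simp add: algebra_simps)
            then have "int m * (2 * k - E * int L) \<le> int m * (hq (sum_list V) - \<delta> * \<delta> - b * \<delta>)"
              by (intro mult_left_mono) auto
            moreover have "4 * int L ^ 2 \<le> int m * (2 * k - E * int L)"
            proof -
              have "(32 * int C0 ^ 2 * E) * int L \<le> int L * int L" using L' by (intro mult_right_mono) auto
              then show ?thesis using area by (simp add: m_def power2_eq_square algebra_simps)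
            qed
            ultimately show "4 * int L ^ 2 \<le> int m * (hq (sum_list V) - \<delta> * \<delta> - b * \<delta>)" by linarith
          qed
          moreover have "int (length V) + int i * int R \<le> int L"
            using that(3) unfolding of_nat_mult[symmetric] of_nat_add[symmetric] of_nat_le_iff .
          moreover have "int C2 * (int M + 1) = int i * (int R - 1) + int C2 * (K + 2)"
            by (simp add: M R algebra_simps)
          ultimately show ?thesis by (simp add: algebra_simps)
        qed
        obtain W0 where W0: "set W0 \<subseteq> S" "length W0 = L" "sum_list W0 = pw gz k"
          unfolding L_def by (metis geodesic_word)
        have "det g (sum_list W0) \<le> 0" by (simp add: W0 det_def)
        then obtain P Q where PQ: "W0 = P @ Q" "\<And>i. det g (sum_list (take i (Q @ P))) \<le> 0"
          by (rule rotate_to_maximal_level) blast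
        define W where "W = Q @ P"
        have z: "sum_list P + sum_list Q = pw gz k" using W0 PQ by simp
        have "hx (sum_list P + sum_list Q) = 0" "hy (sum_list P + sum_list Q) = 0"
            "hq (sum_list P + sum_list Q) = 2 * k"
          by (simp_all only: z hx_pw hy_pw hq_pw h_generators)
        then have W: "hx (sum_list W) = 0" "hy (sum_list W) = 0" "hq (sum_list W) = 2 * k"
          by (auto simp: W_def hq_add eq_neg_iff_add_eq_0[symmetric] algebra_simps)
        have "lowered g W" "length W = L"
          using W0 PQ W K by (auto simp: lowered_def W_def[symmetric] det_def) (auto simp: W_def)
        have "dot g (sum_list W) = 0" using W by (simp add: dot_def)
        have "2 * R * (I + 1) \<le> length W"
          using L parts unfolding L1_def \<open>length W = L\<close> by linarith
        moreover have "step_error (int R) (n1 g + 2 * K + 2 * int R * K) \<le> int (length W)"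
        proof -
          have "step_error (int R) (n1 g + 2 * K + 2 * int R * K) \<le> step_error (int R) (\<beta> + 2 * int R * K)"
            using g(1) by (intro step_error_mono) (auto simp: \<beta>_def)
          then show ?thesis using L parts unfolding L1_def \<open>length W = L\<close> by linarith
        qed
        ultimately consider
          (inside) V where "lowered g V" "length V + I * R \<le> L"
            "\<bar>hq (sum_list V) - 2 * k\<bar> \<le> int I * T * int L" "\<bar>dot g (sum_list V)\<bar> < dot g g"
        | (outside) i V where "i \<le> I" "lowered g V" "length V + i * R \<le> L"
            "\<bar>hq (sum_list V) - 2 * k\<bar> \<le> int i * T * int L"
            "\<bar>dot g (sum_list V)\<bar> \<le> int i * (2 * int R * K * n1 g)"
            "dot g g \<le> \<bar>dot g (sum_list V)\<bar>" "\<bar>dot g (sum_list V)\<bar> \<le> dot g g + 2 * int R * K * n1 g"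
          using walk[OF \<open>lowered g W\<close> \<open>dot g (sum_list W) = 0\<close> False, of R I]
          unfolding \<open>length W = L\<close> W(3) T_def[symmetric] by blast
        then show ?thesis
        proof cases
          case inside
          \<comment> \<open>Then the word would close up to a word for \<open>pw gz k\<close> that is shorter than a geodesic.\<close>
          have n1: "n1 (sum_list V) \<le> \<beta>" using inside_bound[OF inside(1,4) False] g(1) by (simp add: \<beta>_def)
          have "int (wl (pw gz k)) \<le> int L - int I + e * \<beta> + int C2 * (K + 2)"
          proof (rule fin[of V])
            show "set V \<subseteq> S" using inside(1) by (simp add: lowered_def)
            show "\<bar>hq (sum_list V) - 2 * k\<bar> \<le> int I * T * int L + 2 * K * int L"
              using inside(3) K by (simp add: add_increasing2)
            show "n1 (sum_list V) \<le> b" using n1 nonneg by (simp add: b_def)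
            show "\<bar>hx (pw gz k) - hx (sum_list V)\<bar> + \<bar>hy (pw gz k) - hy (sum_list V)\<bar> \<le> \<beta>"
              using n1 by (simp add: n1_def)
          qed (use inside nonneg \<open>0 \<le> \<delta>0\<close> in \<open>auto simp: \<delta>m_def\<close>)
          then have "int I \<le> e * \<beta> + int C2 * (K + 2)" unfolding L_def by linarith
          then show ?thesis unfolding I_def by linarith
        next
          case outside
          obtain V' where V': "set V' \<subseteq> S" "length V' = length V"
              "\<bar>hq (sum_list V') - 2 * k\<bar> \<le> int i * T * int L + 2 * K * int L"
              "dot g (sum_list V') = \<bar>dot g (sum_list V)\<bar>" "\<bar>det g (sum_list V')\<bar> \<le> K * n1 g"
          proof (cases "0 \<le> dot g (sum_list V)")
            case True
            show thesis
            proof (rule that[of V])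
              show "\<bar>hq (sum_list V) - 2 * k\<bar> \<le> int i * T * int L + 2 * K * int L"
                using outside(4) K by (simp add: add_increasing2)
            qed (use True outside(2) lowered_total[OF outside(2)] in \<open>auto simp: lowered_def\<close>)
          next
            case neg: False
            have "set V \<subseteq> S" using outside(2) by (simp add: lowered_def)
            then obtain V' where f: "set V' \<subseteq> S" "length V' = length V" "hx (sum_list V') = - hx (sum_list V)"
                "hy (sum_list V') = - hy (sum_list V)"
                "\<bar>hq (sum_list V') - hq (sum_list V)\<bar> \<le> 2 * K * int (length V)"
              by (rule flip_word)
            show thesis
            proof (rule that[of V'])
              have "2 * K * int (length V) \<le> 2 * K * int L" using outside(3) K by (intro mult_left_mono) auto
              then show "\<bar>hq (sum_list V') - 2 * k\<bar> \<le> int i * T * int L + 2 * K * int L"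
                using outside(4) f(5) by linarith
              have "dot g (sum_list V') = - dot g (sum_list V)" by (simp add: dot_def f)
              then show "dot g (sum_list V') = \<bar>dot g (sum_list V)\<bar>" using neg by simp
              have "det g (sum_list V') = - det g (sum_list V)" by (simp add: det_def f)
              then show "\<bar>det g (sum_list V')\<bar> \<le> K * n1 g"
                using lowered_total[OF outside(2)] outside(2) by (simp add: lowered_def)
            qed (use f in auto)
          qed
          define \<delta> where "\<delta> = \<bar>hx (sum_list V') - hx g\<bar> + \<bar>hy (sum_list V') - hy g\<bar>"
          have pos: "0 < dot g g" by (rule dot_self_pos[OF False])
          have "\<delta> \<le> \<delta>0"
          proof -
            have "dot g g * \<delta> \<le> (\<bar>dot g (sum_list V') - dot g g\<bar> + \<bar>det g (sum_list V') - det g g\<bar>) * n1 g"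
              unfolding \<delta>_def by (rule n1_from_components[OF HOL.refl HOL.refl False])
            also have "\<dots> \<le> (2 * int R * K * n1 g + K * n1 g) * n1 g"
              using V'(4,5) outside(6,7) by (intro mult_right_mono add_mono) auto
            also have "\<dots> = (2 * int R * K + K) * (n1 g * n1 g)" by (simp add: algebra_simps)
            also have "\<dots> \<le> (2 * int R * K + K) * (2 * dot g g)"
              using K n1_square_le[of g] by (intro mult_left_mono) auto
            also have "\<dots> = dot g g * \<delta>0" by (simp add: \<delta>0_def algebra_simps)
            finally show ?thesis using pos by simp
          qed
          have "int (wl g) \<le> int L - int i + e * \<delta>0 + int C2 * (K + 2)"
          proof (rule fin[of V'])
            show "length V' + i * R \<le> L" using outside V' by simp
            show "n1 (sum_list V') \<le> b"
              using \<open>\<delta> \<le> \<delta>0\<close> g(1) K nonneg unfolding n1_def \<delta>_def b_def \<delta>m_def \<beta>_def by linarith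
            show "\<bar>hx g - hx (sum_list V')\<bar> + \<bar>hy g - hy (sum_list V')\<bar> \<le> \<delta>0"
              using \<open>\<delta> \<le> \<delta>0\<close> unfolding \<delta>_def by linarith
          qed (use outside V' nonneg k \<open>0 \<le> \<delta>0\<close> in \<open>auto simp: \<delta>m_def\<close>)
          then have gain: "int i \<le> int L - int (wl g) + C" by (simp add: C_def)
          have "n1 g * n1 g \<le> 2 * dot g g" by (rule n1_square_le)
          also have "\<dots> \<le> 2 * (int i * (2 * int R * K * n1 g))" using outside(5,6) by linarith
          also have "\<dots> = n1 g * (c * int i)" by (simp add: c_def algebra_simps)
          finally have "n1 g \<le> c * int i" using False n1_nonneg[of g] by simp
          also have "\<dots> \<le> c * (int L - int (wl g) + C)" using gain \<open>0 < c\<close> by (intro mult_left_mono) auto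
          finally show ?thesis using k unfolding L_def by blast
        qed
      qed
    qed
  qed
qed

end


section \<open>The complete growth series is not algebraic\<close>

context heis_generators
begin

lemma keys_complete_growth_series:
  "g \<in> keys (fps_nth (complete_growth_series S) n) \<longleftrightarrow> wl g = n"
  by (simp add: complete_growth_series_def keys_sum_nat[OF finite_sphere])

text \<open>If the pump did not move the displacement, the quadratic contribution \<open>det v x\<close> of the pump would
  vanish and the area would be affine in \<open>k\<close>, so the length would be \<open>O(\<surd>k)\<close>. The number \<open>t\<close> is chosen such
  that \<open>k = t\<^sup>2\<close> makes this visible.\<close>

lemma linear_growth_moves:
  assumes p: "0 < p" and growth: "\<And>k::nat. int (wl (u + ((\<lambda>h. v + h + x) ^^ k) w + y)) = a + int k * p"
  shows "hx v + hx x \<noteq> 0 \<or> hy v + hy x \<noteq> 0"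
proof (rule ccontr)
  assume "\<not> ?thesis"
  then have D: "hx x = - hx v" "hy x = - hy v" by auto
  obtain C :: nat where C: "\<And>g r. \<bar>hq g\<bar> \<le> int r ^ 2 \<Longrightarrow> int (wl g) \<le> int C * (n1 g + int r + 1)"
    using wl_upper_bound by blast
  define h where "h k = ((\<lambda>h. v + h + x) ^^ k) w" for k
  define s where "s = hq v + hq x + det v w + det v x + det w x"
  have hxy: "hx (h k) = hx w" "hy (h k) = hy w" for k
    by (induction k) (auto simp: h_def D)
  have hq: "hq (h k) = hq w + int k * s" for k
  proof (induction k)
    case (Suc k)
    have "h (Suc k) = v + h k + x" by (simp add: h_def)
    then have "hq (h (Suc k)) = hq (h k) + s"
      by (simp add: hq_add hxy s_def det_def algebra_simps)
    then show ?case using Suc by (simp add: algebra_simps)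
  qed (simp add: h_def)
  define q0 where "q0 = hq (u + w + y)"
  define n0 where "n0 = n1 (u + w + y)"
  have q: "hq (u + h k + y) = q0 + int k * s" and n: "n1 (u + h k + y) = n0" for k
    by (simp_all add: q0_def n0_def hq_add hxy hq n1_def)
  define B where "B = nat (\<bar>q0\<bar> + \<bar>s\<bar>) + 1"
  define t where "t = C * (nat n0 + B + 1) + nat \<bar>a\<bar> + 1"
  have "1 \<le> t" by (simp add: t_def)
  have "\<bar>hq (u + h (t * t) + y)\<bar> \<le> \<bar>q0\<bar> + int (t * t) * \<bar>s\<bar>"
    unfolding q by (metis abs_mult abs_of_nat abs_triangle_ineq)
  also have "\<dots> \<le> int (t * t) * \<bar>q0\<bar> + int (t * t) * \<bar>s\<bar>"
  proof -
    have "1 * 1 \<le> t * t" using \<open>1 \<le> t\<close> by (intro mult_le_mono)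
    then have "1 * \<bar>q0\<bar> \<le> int (t * t) * \<bar>q0\<bar>" by (intro mult_right_mono) linarith+
    then show ?thesis by simp
  qed
  also have "\<dots> \<le> int (t * t) * int B" by (simp add: B_def distrib_left)
  also have "\<dots> \<le> int (t * t) * (int B * int B)"
  proof -
    have "B \<le> B * B" by (rule le_square)
    then have "int B \<le> int B * int B" by (metis of_nat_le_iff of_nat_mult)
    then show ?thesis by (rule mult_left_mono) simp
  qed
  also have "\<dots> = int (t * B) ^ 2" by (simp add: power2_eq_square)
  finally have "int (wl (u + h (t * t) + y)) \<le> int C * (n0 + int (t * B) + 1)"
    using C n by metis
  also have "\<dots> \<le> int C * (int t * (n0 + int B + 1))"
  proof (intro mult_left_mono)
    have "0 \<le> n0" by (simp add: n0_def)
    then have "1 * (n0 + 1) \<le> int t * (n0 + 1)" using \<open>1 \<le> t\<close> by (intro mult_right_mono) auto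
    then show "n0 + int (t * B) + 1 \<le> int t * (n0 + int B + 1)" by (simp add: algebra_simps)
  qed simp
  also have "\<dots> = int t * (int C * (n0 + int B + 1))" by simp
  also have "\<dots> < int t * int t - \<bar>a\<bar>"
  proof -
    have "0 \<le> n0" by (simp add: n0_def)
    then have "int C * (n0 + int B + 1) = int t - \<bar>a\<bar> - 1" by (simp add: t_def algebra_simps)
    moreover have "1 * \<bar>a\<bar> \<le> int t * \<bar>a\<bar>" using \<open>1 \<le> t\<close> by (intro mult_right_mono) auto
    ultimately have "int t * (int C * (n0 + int B + 1)) = int t * int t - int t * \<bar>a\<bar> - int t"
      by (simp only:) (simp add: algebra_simps)
    then show ?thesis using \<open>1 \<le> t\<close> \<open>1 * \<bar>a\<bar> \<le> int t * \<bar>a\<bar>\<close> by linarith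
  qed
  also have "\<dots> \<le> a + int (t * t) * p"
  proof -
    have "int (t * t) * 1 \<le> int (t * t) * p" using p by (intro mult_left_mono) auto
    then show ?thesis by simp
  qed
  finally show False using growth[of "t * t"] by (simp add: h_def)
qed

text \<open>By \<open>wl_upper_bound\<close> the area is at least quadratic in the length when the displacement is bounded, so
  for long elements it exceeds any given affine function of the length.\<close>

lemma long_elements_have_large_area:
  fixes \<alpha> \<gamma> \<rho> :: nat
  obtains N where "\<And>g. n1 g \<le> int \<rho> \<Longrightarrow> N \<le> wl g \<Longrightarrow> int \<alpha> * int (wl g) + int \<gamma> < \<bar>hq g\<bar>"
proof -
  obtain C :: nat where C: "\<And>g r. \<bar>hq g\<bar> \<le> int r ^ 2 \<Longrightarrow> int (wl g) \<le> int C * (n1 g + int r + 1)"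
    using wl_upper_bound by blast
  define t where "t = 2 * C + 1"
  define r0 where "r0 = 2 * (\<alpha> * t) + \<gamma> + C * (\<rho> + 1) + 1"
  show thesis
  proof (rule that[of "t * r0"])
    fix g assume g: "n1 g \<le> int \<rho>" "t * r0 \<le> wl g"
    define r where "r = wl g div t"
    have "0 < t" by (simp add: t_def)
    have r: "t * r \<le> wl g" "wl g < t * (r + 1)"
      using \<open>0 < t\<close> by (auto simp: r_def dividend_less_times_div)
    have "t * r0 < t * (r + 1)" using g(2) r(2) by linarith
    then have "r0 < r + 1" using mult_less_cancel1 by blast
    then have r0: "r0 \<le> r" by simp
    show "int \<alpha> * int (wl g) + int \<gamma> < \<bar>hq g\<bar>"
    proof (rule ccontr)
      assume "\<not> ?thesis"
      then have "\<bar>hq g\<bar> \<le> int (\<alpha> * wl g + \<gamma>)" by simp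
      also have "\<alpha> * wl g + \<gamma> \<le> r ^ 2"
      proof -
        have "\<alpha> * wl g \<le> \<alpha> * (t * (r + 1))" using r(2) by (intro mult_le_mono2) simp
        moreover have "\<alpha> * (t * (r + 1)) + \<gamma> \<le> (2 * (\<alpha> * t) + \<gamma>) * r"
        proof -
          have "1 \<le> r" using r0 by (simp add: r0_def)
          then have "\<alpha> * t * 1 + \<gamma> * 1 \<le> \<alpha> * t * r + \<gamma> * r" by (intro add_mono mult_le_mono2)
          then show ?thesis by (simp add: algebra_simps)
        qed
        moreover have "(2 * (\<alpha> * t) + \<gamma>) * r \<le> r * r"
          using r0 by (intro mult_le_mono1) (simp add: r0_def)
        ultimately show ?thesis unfolding power2_eq_square by linarith
      qed
      finally have "int (wl g) \<le> int C * (n1 g + int r + 1)" using C[of g r] by simp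
      also have "\<dots> \<le> int C * (int \<rho> + int r + 1)" using g(1) by (intro mult_left_mono) auto
      finally have "int (wl g) \<le> int (C * (\<rho> + r + 1))" by (simp add: algebra_simps)
      then have "wl g \<le> C * (\<rho> + 1) + C * r" by (simp only: of_nat_le_iff algebra_simps)
      moreover have "C * (\<rho> + 1) < r" using r0 by (simp add: r0_def)
      moreover have "t * r = C * r + C * r + r" by (simp add: t_def algebra_simps)
      ultimately show False using r(1) by linarith
    qed
  qed
qed

lemma unbounded_length: "\<exists>k\<ge>0. T \<le> wl (pw gz k)"
proof -
  define k where "k = int T * (K * (1 + K * int T)) + 1"
  have "0 \<le> int T * (K * (1 + K * int T))" using K_pos by simp
  then have k: "1 \<le> k" by (simp add: k_def)
  have "T \<le> wl (pw gz k)"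
  proof (rule ccontr)
    assume *: "\<not> ?thesis"
    let ?l = "int (wl (pw gz k))"
    have "2 * k \<le> ?l * (K * (1 + K * ?l))" using hq_wl[of "pw gz k"] k by simp
    also have "\<dots> \<le> int T * (K * (1 + K * int T))"
      using * K_pos by (intro mult_mono add_left_mono mult_left_mono) auto
    also have "\<dots> = k - 1" by (simp add: k_def)
    finally show False using k by linarith
  qed
  then show ?thesis using k by (intro exI[of _ k]) auto
qed

lemma square_sum_le:
  assumes "n1 g \<le> int \<rho>" "0 < \<rho>"
  shows "real_of_int (hx g ^ 2 + hy g ^ 2) / real \<rho> ^ 2 \<le> 1"
proof -
  have "hx g ^ 2 + hy g ^ 2 \<le> n1 g ^ 2"
    unfolding n1_def by (simp add: power2_sum)
  also have "\<dots> \<le> int \<rho> ^ 2" using assms by (intro power_mono) auto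
  finally have "real_of_int (hx g ^ 2 + hy g ^ 2) \<le> real_of_int (int \<rho> ^ 2)" by (simp only: of_int_le_iff)
  then show ?thesis using assms(2) by (simp add: divide_le_eq)
qed

text \<open>The maximum principle described at the beginning. Here \<open>b\<close> bounds the finite set \<open>E\<close> of pumped
  pieces, so pumping moves the displacement by at most \<open>2 * b\<close>. The radius \<open>\<rho>\<close> is such that an element within
  \<open>2 * b\<close> of the boundary is shorter than a central element by more than \<open>3\<close>, while the terms with \<open>\<eta>\<close>
  and \<open>\<epsilon>\<close> differ by at most \<open>2\<close>.\<close>

theorem growth_series_not_algebraic: "\<not> algebraic_series (complete_growth_series S)"
proof
  assume alg: "algebraic_series (complete_growth_series S)"
  obtain N0 C0 :: nat and E where "finite E" and pump0:
    "\<And>g n. g \<in> keys (fps_nth (complete_growth_series S) n) \<Longrightarrow> N0 \<le> n \<Longrightarrow>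
      \<exists>u v w x y p. 0 < p \<and> p \<le> n \<and> g = u + (v + w + x) + y \<and> nat (n1 u) \<le> C0 * n \<and>
        w \<in> E \<and> v + w + x \<in> E \<and> v + (v + w + x) + x \<in> E \<and>
        (\<forall>k. n - p + k * p > 0 \<and>
          u + ((\<lambda>h. v + h + x) ^^ k) w + y \<in> keys (fps_nth (complete_growth_series S) (n - p + k * p)))"
  proof (rule pumping[OF alg, of "\<lambda>g. nat (n1 g)"])
    show "nat (n1 (g + h)) \<le> nat (n1 g) + nat (n1 h)" for g h
      using n1_add[of g h] n1_nonneg[of g] n1_nonneg[of h] by linarith
  qed (simp, blast)
  define b where "b = (\<Sum>e\<in>E. nat (n1 e) + nat \<bar>hq e\<bar>) + 1"
  have b: "n1 e \<le> int b" "\<bar>hq e\<bar> \<le> int b" if "e \<in> E" for e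
  proof -
    have "nat (n1 e) + nat \<bar>hq e\<bar> \<le> b"
      using member_le_sum[OF that, of "\<lambda>e. nat (n1 e) + nat \<bar>hq e\<bar>"] \<open>finite E\<close> by (simp add: b_def)
    then show "n1 e \<le> int b" "\<bar>hq e\<bar> \<le> int b" by linarith+
  qed
  have "1 \<le> b" by (simp add: b_def)
  \<comment> \<open>A long element lies halfway, in length and displacement and up to a bounded error in area,
    between two elements with other displacements.\<close>
  have pump: "\<exists>g1 g2. int (wl g1) + int (wl g2) = 2 * int (wl g) \<and>
      hx g1 + hx g2 = 2 * hx g \<and> hy g1 + hy g2 = 2 * hy g \<and> (hx g1 \<noteq> hx g \<or> hy g1 \<noteq> hy g) \<and>
      n1 g1 \<le> n1 g + 2 * int b \<and> n1 g2 \<le> n1 g + 2 * int b \<and>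
      \<bar>hq g1 + hq g2 - 2 * hq g\<bar> \<le> 4 * int b \<and>
      \<bar>hq g1 - hq g\<bar> \<le> 2 * int b + 2 * int b * (n1 g + 2 * (int C0 * int (wl g)) + int b) \<and>
      \<bar>hq g2 - hq g\<bar> \<le> 2 * int b + 2 * int b * (n1 g + 2 * (int C0 * int (wl g)) + int b)"
    if long: "N0 \<le> wl g" for g
  proof -
    obtain u v w x y p where p: "0 < p" "p \<le> wl g" "g = u + (v + w + x) + y" "nat (n1 u) \<le> C0 * wl g"
        "w \<in> E" "v + w + x \<in> E" "v + (v + w + x) + x \<in> E"
        "\<And>k. wl (u + ((\<lambda>h. v + h + x) ^^ k) w + y) = wl g - p + k * p"
      using pump0[unfolded keys_complete_growth_series, OF HOL.refl long] by metis
    define e1 e e2 where "e1 = w" and "e = v + w + x" and "e2 = v + (v + w + x) + x"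
    define g1 g2 where "g1 = u + e1 + y" and "g2 = u + e2 + y"
    have g: "g = u + e + y" by (simp add: p(3) e_def)
    have E: "e1 \<in> E" "e \<in> E" "e2 \<in> E" using p by (simp_all add: e1_def e_def e2_def)
    have "hx v + hx x \<noteq> 0 \<or> hy v + hy x \<noteq> 0"
      using linear_growth_moves[of "int p" u v x w y "int (wl g - p)"] p(1,8) by simp
    moreover have "wl g1 = wl g - p" "wl g2 = wl g + p"
      using p(8)[of 0] p(8)[of 2] p(2) by (simp_all add: g1_def g2_def e1_def e2_def numeral_2_eq_2)
    moreover have disp: "hx e1 + hx e2 = 2 * hx e" "hy e1 + hy e2 = 2 * hy e"
      by (simp_all add: e1_def e_def e2_def)
    moreover have area: "\<bar>hq (u + f + y) - hq g\<bar> \<le> 2 * int b + 2 * int b * (n1 g + 2 * (int C0 * int (wl g)) + int b)"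
      and far: "n1 (u + f + y) \<le> n1 g + 2 * int b" if "f \<in> E" for f
    proof -
      have nu: "n1 u \<le> int C0 * int (wl g)" using p(4) by (simp add: nat_le_iff)
      have ny: "n1 y \<le> n1 g + n1 u + int b"
        using b(1)[OF E(2)] unfolding g n1_def by simp
      have diff: "n1 (f - e) \<le> 2 * int b"
        using b(1)[OF E(2)] b(1)[OF that] unfolding n1_def by simp
      have "n1 (u + f + y) \<le> n1 g + n1 (f - e)" unfolding g n1_def by simp
      then show "n1 (u + f + y) \<le> n1 g + 2 * int b" using diff by linarith
      have "hq (u + f + y) - hq g = hq f - hq e + det u (f - e) - det y (f - e)"
        unfolding g by (simp add: hq_add det_def algebra_simps)
      moreover have "\<bar>det u (f - e)\<bar> \<le> n1 u * (2 * int b)"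
        using det_le[of u "f - e"] mult_left_mono[OF diff n1_nonneg[of u]] by linarith
      moreover have "\<bar>det y (f - e)\<bar> \<le> (n1 g + n1 u + int b) * (2 * int b)"
        using det_le[of y "f - e"] mult_mono[OF ny diff] n1_nonneg[of g] n1_nonneg[of u] by simp
      ultimately have "\<bar>hq (u + f + y) - hq g\<bar> \<le> 2 * int b + (n1 g + 2 * n1 u + int b) * (2 * int b)"
        using b(2)[OF E(2)] b(2)[OF that] by (simp add: algebra_simps)
      also have "\<dots> \<le> 2 * int b + (n1 g + 2 * (int C0 * int (wl g)) + int b) * (2 * int b)"
        using nu by (intro add_left_mono mult_right_mono) auto
      finally show "\<bar>hq (u + f + y) - hq g\<bar> \<le> 2 * int b + 2 * int b * (n1 g + 2 * (int C0 * int (wl g)) + int b)"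
        by (simp add: algebra_simps)
    qed
    moreover have "hq g1 + hq g2 - 2 * hq g = hq e1 + hq e2 - 2 * hq e
        + det u (e1 + e2 - e - e) - det y (e1 + e2 - e - e)"
      unfolding g g1_def g2_def by (simp add: hq_add det_def algebra_simps)
    moreover have "\<dots> = hq e1 + hq e2 - 2 * hq e" using disp by (simp add: det_def)
    moreover have "\<bar>hq e1 + hq e2 - 2 * hq e\<bar> \<le> 4 * int b"
      using b(2)[OF E(1)] b(2)[OF E(2)] b(2)[OF E(3)] by linarith
    ultimately show ?thesis
      using area[OF E(1)] area[OF E(3)] far[OF E(1)] far[OF E(3)] p(2) unfolding g1_def[symmetric] g2_def[symmetric]
      by (intro exI[of _ g1] exI[of _ g2] conjI) (auto simp: g g1_def g2_def e1_def e_def of_nat_diff)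
  qed
  obtain c Ck :: int where c: "0 < c" "0 \<le> Ck" and
    farthest: "\<And>\<rho>. \<exists>A. \<forall>g. n1 g \<le> \<rho> \<longrightarrow> A \<le> hq g \<longrightarrow>
       (\<exists>k. \<bar>2 * k - hq g\<bar> \<le> 1 \<and> n1 g \<le> c * (int (wl (pw gz k)) - int (wl g) + Ck))"
    using center_is_farthest by blast
  define \<rho> where "\<rho> = nat (c * (Ck + 3)) + 2 * b"
  have \<rho>: "int \<rho> = c * (Ck + 3) + 2 * int b" "0 < \<rho>" using c \<open>1 \<le> b\<close> by (simp_all add: \<rho>_def)
  obtain A where A: "\<And>g. n1 g \<le> int \<rho> \<Longrightarrow> A \<le> hq g \<Longrightarrow>
      \<exists>k. \<bar>2 * k - hq g\<bar> \<le> 1 \<and> n1 g \<le> c * (int (wl (pw gz k)) - int (wl g) + Ck)"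
    using farthest[of "int \<rho>"] by blast
  define \<gamma> where "\<gamma> = nat \<bar>A\<bar> + 2 * b + 2 * b * (\<rho> + b) + 1"
  obtain N1 where N1: "\<And>g. n1 g \<le> int \<rho> \<Longrightarrow> N1 \<le> wl g \<Longrightarrow> int (4 * b * C0) * int (wl g) + int \<gamma> < \<bar>hq g\<bar>"
    using long_elements_have_large_area by blast
  obtain k0 where k0: "0 \<le> k0" "N0 + N1 + 3 \<le> wl (pw gz k0)" using unbounded_length by blast
  define \<eta> where "\<eta> = 1 / real \<rho> ^ 2"
  define \<epsilon> where "\<epsilon> = min (\<eta> / (4 * real b + 1)) (1 / (2 * real_of_int k0 + 1))"
  have \<eta>: "0 < \<eta>" using \<rho>(2) by (simp add: \<eta>_def)
  have \<epsilon>: "0 < \<epsilon>" "\<epsilon> * (4 * real b) < \<eta>" "\<epsilon> * (2 * real_of_int k0) \<le> 1" "\<epsilon> \<le> 1"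
  proof -
    show "0 < \<epsilon>" using \<eta> k0 by (simp add: \<epsilon>_def)
    have "\<epsilon> \<le> \<eta> / (4 * real b + 1)" by (simp add: \<epsilon>_def)
    then have "\<epsilon> * (4 * real b + 1) \<le> \<eta>" by (simp add: pos_le_divide_eq)
    then show "\<epsilon> * (4 * real b) < \<eta>" using \<open>0 < \<epsilon>\<close> by (simp add: algebra_simps)
    have "\<epsilon> \<le> 1 / (2 * real_of_int k0 + 1)" by (simp add: \<epsilon>_def)
    then have *: "\<epsilon> * (2 * real_of_int k0 + 1) \<le> 1" using k0(1) by (subst (asm) pos_le_divide_eq) auto
    then show "\<epsilon> * (2 * real_of_int k0) \<le> 1" using \<open>0 < \<epsilon>\<close> by (simp add: algebra_simps)
    have "0 \<le> \<epsilon> * (2 * real_of_int k0)" using \<open>0 < \<epsilon>\<close> k0 by simp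
    then show "\<epsilon> \<le> 1" using * by (simp add: algebra_simps)
  qed
  define sq where "sq g = real_of_int (hx g ^ 2 + hy g ^ 2)" for g
  define \<Psi> where "\<Psi> g = real (wl g) - \<epsilon> * real_of_int (hq g) + \<eta> * sq g" for g
  define \<Omega> where "\<Omega> = {g. n1 g \<le> int \<rho> \<and> 0 \<le> hq g}"
  have sq: "0 \<le> \<eta> * sq g" "n1 g \<le> int \<rho> \<Longrightarrow> \<eta> * sq g \<le> 1" for g
    using square_sum_le[of g \<rho>] \<rho>(2) \<eta> by (auto simp: \<eta>_def sq_def)
  \<comment> \<open>\<open>\<Psi>\<close> attains its maximum on \<open>\<Omega>\<close>.\<close>
  have "finite {g \<in> \<Omega>. 0 \<le> \<Psi> g}"
  proof -
    define \<alpha> where "\<alpha> = nat \<lceil>1 / \<epsilon>\<rceil>"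
    have \<alpha>: "1 \<le> \<epsilon> * real \<alpha>"
    proof -
      have "1 / \<epsilon> \<le> real \<alpha>" unfolding \<alpha>_def by linarith
      then show ?thesis using \<epsilon>(1) by (simp add: field_simps)
    qed
    obtain N2 where N2: "\<And>g. n1 g \<le> int \<rho> \<Longrightarrow> N2 \<le> wl g \<Longrightarrow> int \<alpha> * int (wl g) + int \<alpha> < \<bar>hq g\<bar>"
      using long_elements_have_large_area by blast
    have "wl g < N2" if "g \<in> \<Omega>" "0 \<le> \<Psi> g" for g
    proof (rule ccontr)
      assume "\<not> ?thesis"
      then have "int \<alpha> * int (wl g) + int \<alpha> < hq g" using N2[of g] that(1) by (simp add: \<Omega>_def)
      then have *: "real \<alpha> * (real (wl g) + 1) < real_of_int (hq g)"
        unfolding of_int_less_iff[of _ "hq g", where 'a = real, symmetric] by (simp add: algebra_simps)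
      have "1 * (real (wl g) + 1) \<le> \<epsilon> * real \<alpha> * (real (wl g) + 1)"
        using \<alpha> by (intro mult_right_mono) auto
      also have "\<dots> = \<epsilon> * (real \<alpha> * (real (wl g) + 1))" by (rule mult.assoc)
      also have "\<dots> < \<epsilon> * real_of_int (hq g)" using * \<epsilon>(1) by (rule mult_strict_left_mono)
      finally have "real (wl g) + 1 < \<epsilon> * real_of_int (hq g)" by simp
      moreover have "\<eta> * sq g \<le> 1" using sq that(1) by (simp add: \<Omega>_def)
      ultimately show False using that(2) unfolding \<Psi>_def by linarith
    qed
    then have "{g \<in> \<Omega>. 0 \<le> \<Psi> g} \<subseteq> (\<Union>n<N2. {g. wl g = n})" by auto
    then show ?thesis by (rule finite_subset) (use finite_sphere in auto)
  qed
  moreover have "0 \<in> {g \<in> \<Omega>. 0 \<le> \<Psi> g}" by (simp add: \<Omega>_def \<Psi>_def sq_def)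
  ultimately have "Max (\<Psi> ` {g \<in> \<Omega>. 0 \<le> \<Psi> g}) \<in> \<Psi> ` {g \<in> \<Omega>. 0 \<le> \<Psi> g}" by (intro Max_in) auto
  then obtain g where g: "g \<in> \<Omega>" "0 \<le> \<Psi> g" "Max (\<Psi> ` {g \<in> \<Omega>. 0 \<le> \<Psi> g}) = \<Psi> g" by auto
  have max: "\<Psi> h \<le> \<Psi> g" if "h \<in> \<Omega>" for h
  proof (cases "0 \<le> \<Psi> h")
    case True
    then have "\<Psi> h \<in> \<Psi> ` {g \<in> \<Omega>. 0 \<le> \<Psi> g}" using that by blast
    then show ?thesis
      unfolding g(3)[symmetric] using \<open>finite {g \<in> \<Omega>. 0 \<le> \<Psi> g}\<close> by (intro Max_ge) auto
  next
    case False
    then show ?thesis using g(2) by linarith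
  qed
  \<comment> \<open>The maximiser is long, because \<open>\<epsilon>\<close> is small.\<close>
  have "N0 + N1 \<le> wl g"
  proof -
    have "pw gz k0 \<in> \<Omega>" using k0(1) by (simp add: \<Omega>_def n1_def)
    then have "\<Psi> (pw gz k0) \<le> \<Psi> g" by (rule max)
    moreover have "real (wl (pw gz k0)) - 1 \<le> \<Psi> (pw gz k0)"
      using \<epsilon>(3) by (simp add: \<Psi>_def sq_def mult.commute)
    moreover have "\<Psi> g \<le> real (wl g) + 1"
    proof -
      have "0 \<le> \<epsilon> * real_of_int (hq g)" using \<epsilon>(1) g(1) by (simp add: \<Omega>_def)
      moreover have "\<eta> * sq g \<le> 1" using sq(2) g(1) by (simp add: \<Omega>_def)
      ultimately show ?thesis unfolding \<Psi>_def by linarith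
    qed
    ultimately have "real (N0 + N1 + 3) \<le> real (wl g) + 2" using k0(2) by linarith
    then show ?thesis by linarith
  qed
  have n1g: "n1 g \<le> int \<rho>" using g(1) by (simp add: \<Omega>_def)
  have hqg: "int (4 * b * C0) * int (wl g) + int \<gamma> < hq g"
    using N1[OF n1g] \<open>N0 + N1 \<le> wl g\<close> g(1) by (simp add: \<Omega>_def)
  have "0 \<le> int (4 * b * C0) * int (wl g)" by simp
  \<comment> \<open>It is not close to the boundary of \<open>\<Omega>\<close>, because the centre contains a longer element.\<close>
  have inner: "n1 g \<le> int \<rho> - 2 * int b"
  proof (rule ccontr)
    assume *: "\<not> ?thesis"
    have "A \<le> hq g" using hqg \<open>0 \<le> int (4 * b * C0) * int (wl g)\<close> unfolding \<gamma>_def by linarith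
    then obtain k where k: "\<bar>2 * k - hq g\<bar> \<le> 1" "n1 g \<le> c * (int (wl (pw gz k)) - int (wl g) + Ck)"
      using A[OF n1g] by blast
    have "c * (Ck + 3) < c * (int (wl (pw gz k)) - int (wl g) + Ck)" using * \<rho>(1) k(2) by linarith
    then have "int (wl g) + 3 < int (wl (pw gz k))" using c(1) by simp
    then have longer: "real (wl g) + 3 < real (wl (pw gz k))" by linarith
    have "1 \<le> hq g" using hqg \<open>0 \<le> int (4 * b * C0) * int (wl g)\<close> unfolding \<gamma>_def by linarith
    then have "pw gz k \<in> \<Omega>" using k(1) by (simp add: \<Omega>_def n1_def)
    then have "\<Psi> (pw gz k) \<le> \<Psi> g" by (rule max)
    moreover have "\<epsilon> * real_of_int (hq (pw gz k)) \<le> \<epsilon> * real_of_int (hq g) + 1"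
    proof -
      have "real_of_int (hq (pw gz k)) \<le> real_of_int (hq g) + 1" using k(1) by simp
      then have "\<epsilon> * real_of_int (hq (pw gz k)) \<le> \<epsilon> * (real_of_int (hq g) + 1)"
        using \<epsilon>(1) by (intro mult_left_mono) auto
      then show ?thesis using \<epsilon>(4) by (simp add: algebra_simps)
    qed
    moreover have "\<eta> * sq g \<le> 1" using sq(2)[OF n1g] .
    ultimately show False using longer sq(1)[of "pw gz k"] unfolding \<Psi>_def by linarith
  qed
  \<comment> \<open>Hence both pumped elements lie in \<open>\<Omega>\<close>, which contradicts the strict convexity of the
    quadratic term.\<close>
  obtain g1 g2 where p: "int (wl g1) + int (wl g2) = 2 * int (wl g)"
      "hx g1 + hx g2 = 2 * hx g" "hy g1 + hy g2 = 2 * hy g" "hx g1 \<noteq> hx g \<or> hy g1 \<noteq> hy g"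
      "n1 g1 \<le> n1 g + 2 * int b" "n1 g2 \<le> n1 g + 2 * int b"
      "\<bar>hq g1 + hq g2 - 2 * hq g\<bar> \<le> 4 * int b"
      "\<bar>hq g1 - hq g\<bar> \<le> 2 * int b + 2 * int b * (n1 g + 2 * (int C0 * int (wl g)) + int b)"
      "\<bar>hq g2 - hq g\<bar> \<le> 2 * int b + 2 * int b * (n1 g + 2 * (int C0 * int (wl g)) + int b)"
    using pump[of g] \<open>N0 + N1 \<le> wl g\<close> by (meson add_leD1)
  have "2 * int b + 2 * int b * (n1 g + 2 * (int C0 * int (wl g)) + int b) \<le> hq g"
  proof -
    have "2 * int b * (n1 g + 2 * (int C0 * int (wl g)) + int b)
        \<le> 2 * int b * (int \<rho> + 2 * (int C0 * int (wl g)) + int b)"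
      using n1g by (intro mult_left_mono) auto
    then show ?thesis using hqg unfolding \<gamma>_def by (simp add: algebra_simps)
  qed
  then have "g1 \<in> \<Omega>" "g2 \<in> \<Omega>" using p inner unfolding \<Omega>_def by auto
  then have "\<Psi> g1 + \<Psi> g2 \<le> 2 * \<Psi> g" using max[of g1] max[of g2] by linarith
  moreover have "\<eta> * sq g1 + \<eta> * sq g2 - 2 * (\<eta> * sq g) \<ge> 2 * \<eta>"
  proof -
    define dx dy where "dx = hx g1 - hx g" and "dy = hy g1 - hy g"
    have d: "hx g1 = hx g + dx" "hx g2 = hx g - dx" "hy g1 = hy g + dy" "hy g2 = hy g - dy"
      using p(2,3) by (auto simp: dx_def dy_def)
    have "sq g1 + sq g2 - 2 * sq g = real_of_int (2 * (dx ^ 2 + dy ^ 2))"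
      unfolding sq_def d by (simp add: power2_eq_square algebra_simps)
    moreover have "1 \<le> dx ^ 2 + dy ^ 2"
      using p(4) by (smt (verit) dx_def dy_def zero_less_power2 zero_le_power2)
    then have "2 * 1 \<le> 2 * (dx ^ 2 + dy ^ 2)" by (rule mult_left_mono) simp
    then have "2 \<le> real_of_int (2 * (dx ^ 2 + dy ^ 2))" unfolding of_int_le_iff[of _ "2 * (dx ^ 2 + dy ^ 2)", where 'a = real, symmetric] by simp
    ultimately have "\<eta> * 2 \<le> \<eta> * (sq g1 + sq g2 - 2 * sq g)" using \<eta> by (intro mult_left_mono) auto
    then show ?thesis by (simp add: algebra_simps)
  qed
  moreover have "\<epsilon> * real_of_int (hq g1) + \<epsilon> * real_of_int (hq g2) - 2 * (\<epsilon> * real_of_int (hq g)) \<le> \<eta>"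
  proof -
    have "real_of_int (hq g1 + hq g2 - 2 * hq g) \<le> real_of_int (4 * int b)"
      using p(7) by (simp only: of_int_le_iff)
    then have "\<epsilon> * real_of_int (hq g1 + hq g2 - 2 * hq g) \<le> \<epsilon> * (4 * real b)"
      using \<epsilon>(1) by (intro mult_left_mono) auto
    then show ?thesis using \<epsilon>(2) by (simp add: algebra_simps)
  qed
  moreover have "real (wl g1) + real (wl g2) = 2 * real (wl g)" using p(1) by linarith
  ultimately have "2 * \<eta> - \<eta> \<le> 0" unfolding \<Psi>_def by (smt (verit))
  then show False using \<eta> by simp
qed

end

theorem theorem3:
  fixes S :: "heis set"
  assumes "finite S" and "symmetric S" and "generates S"
  shows "\<not> algebraic_series (complete_growth_series S)"
proof -
  interpret heis_generators S by unfold_locales (use assms in auto)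
  show ?thesis by (rule growth_series_not_algebraic)
qed

end
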